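(* Let $P:\mathcal{C}^{\mathrm{op}}\to\mathbf{Hey}$ be a Gödel first-order hyperdoctrine such that existential-free elements are closed with respect to implication and finite conjunction, and falsehood $\bot$ is a quantifier-free predicate. Then for all objects $I,U,X,V,Y$ of $\mathcal{C}$ and all quantifier-free predicates $\psi_D\in P(I\times U\times X)$ and $\phi_D\in P(I\times V\times Y)$ of $P$, the formula $$i:I\mid \bigl(\exists u:U.\,\forall x:X.\,\psi_D(i,u,x)\bigr)\to\bigl(\exists v:V.\,\forall y:Y.\,\phi_D(i,v,y)\bigr)$$ is provably equivalent (i.e. $\dashv\vdash$ in context $i:I$) to $$i:I\mid \exists f_0,f_1.\,\forall u:U,\,y:Y.\,\bigl(\psi_D(i,u,f_1(i,u,y))\to\phi_D(i,f_0(i,u),y)\bigr),$$ where $f_0$ ranges over the exponential $V^{I\times U}$, $f_1$ over the exponential $X^{I\times U\times Y}$, and $f_0(i,u)$, $f_1(i,u,y)$ denote evaluation.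
   Context: A doctrine is a functor $P:\mathcal{C}^{\mathrm{op}}\to\mathbf{Pos}$, where $\mathcal{C}$ has finite products and $\mathbf{Pos}$ is the category of posets and monotone maps. For $f:A\to B$ in $\mathcal{C}$ write $P_f:P(B)\to P(A)$. Elements of $P(A)$ are called predicates. $P$ is existential (resp. universal) if for every product projection $\pi_i:A_1\times A_2\to A_i$ the map $P_{\pi_i}$ has a left adjoint $\exists_{\pi_i}$ (resp. a right adjoint $\forall_{\pi_i}$) and the Beck-Chevalley condition holds: for every pullback square $\pi f'=f\pi'$ with $\pi:X\to A$ and $\pi':X'\to A'$ projections, $f:A'\to A$, $f':X'\to X$, and every $\beta\in P(X)$, $\exists_{\pi'}P_{f'}\beta=P_f\exists_\pi\beta$ (resp. $\forall_{\pi'}P_{f'}\beta=P_f\forall_\pi\beta$). Internal language: $a:A\mid\phi(a)\vdash\psi(a)$ means $\phi\le\psi$ in $P(A)$ (a context with several variables denotes the product of the types); $\dashv\vdash$ means both inequalities. For $\alpha\in P(A\times B)$, $\exists b:B.\,\alpha(a,b)$ and $\forall b:B.\,\alpha(a,b)$ denote $\exists_{\pi_A}\alpha$ and $\forall_{\pi_A}\alpha$ in $P(A)$. Terms are arrows of $\mathcal{C}$ and substitution is reindexing, e.g. $\alpha(a,g(a))$ is $P_{\langle 1_A,g\rangle}\alpha$. Propositional connectives are interpreted by the operations of the fibres. Let $P$ be existential. $\alpha\in P(A)$ is an existential splitting if for every object $B$ and every $\beta\in P(A\times B)$ with $\alpha(a)\vdash\exists b:B.\,\beta(a,b)$ there is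 $g:A\to B$ with $\alpha(a)\vdash\beta(a,g(a))$. $\alpha\in P(I)$ is existential-free if $P_f(\alpha)$ is an existential splitting for every arrow $f:A\to I$. $P$ has enough existential-free predicates if for every $I$ and $\alpha\in P(I)$ there are an object $A$ and an existential-free $\beta\in P(I\times A)$ with $\alpha=\exists_{\pi_I}\beta$. $P^{\exists\text{-free}}$ denotes the subdoctrine of $P$ (same base) whose fibre over $A$ is the set of existential-free elements of $P(A)$ with the induced order. Dually, for $P$ universal, $\alpha\in P(A)$ is a universal splitting if for every $B$ and every $\beta\in P(A\times B)$ with $\forall b:B.\,\beta(a,b)\vdash\alpha(a)$ there is $g:A\to B$ with $\beta(a,g(a))\vdash\alpha(a)$. $\alpha\in P(I)$ is universal-free if $P_f(\alpha)$ is a universal splitting for every $f:A\to I$. $P$ has enough universal-free predicates if for every $I$ and $\alpha\in P(I)$ there are $A$ and a universal-free $\beta\in P(I\times A)$ with $\alpha=\forall_{\pi_I}\beta$. $P$ is a Skolem doctrine if: (i) $\mathcal{C}$ is cartesian closed; (ii) $P$ is existential and universal; (iii) $P$ has enough existential-free predicates; (iv) if $\alpha\in P(A)$ is existential-free then $\forall_\pi(\alpha)$ is existential-free for every projection $\pi$ from $A$ (so $P^{\exists\text{-free}}$ is a universal doctrine, with universal quantifiers those of $P$). $P$ is a Gödel doctrine if it is a Skolem doctrine and the doctrine $P^{\exists\text{-free}}$ has enough universal-free predicates. A predicate of a Gödel doctrine $P$ is quantifier-free if it is existential-free in $P$ and universal-free in the doctrine $P^{\exists\text{-free}}$ (universal-freeness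 being tested only against $\beta$ in $P^{\exists\text{-free}}$). A first-order hyperdoctrine is a functor $P:\mathcal{C}^{\mathrm{op}}\to\mathbf{Hey}$ from a category $\mathcal{C}$ with finite products to Heyting algebras and their homomorphisms such that for every arrow $f$ the map $P_f$ has a left adjoint $\exists_f$ and a right adjoint $\forall_f$, satisfying Beck-Chevalley for every pullback square $fh=gk$ ($h:D\to A$, $k:D\to C$, $f:A\to B$, $g:C\to B$): $\exists_kP_h=P_g\exists_f$ and $\forall_kP_h=P_g\forall_f$. It is a Gödel first-order hyperdoctrine if $P$ is a Gödel doctrine. "$\bot$ is a quantifier-free predicate" means that the bottom element of each fibre is quantifier-free. *)

theory Defs
  imports "HOL-Algebra.Galois_Connection"
begin

section \<open>Categories with finite products\<close>

record ('o, 'a) category =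
  obj :: "'o set"
  arr :: "'a set"
  src :: "'a \<Rightarrow> 'o"
  tgt :: "'a \<Rightarrow> 'o"
  ide :: "'o \<Rightarrow> 'a"
  cmp :: "'a \<Rightarrow> 'a \<Rightarrow> 'a"  (infixl \<open>\<cdot>\<index>\<close> 75)

definition hom :: "('o, 'a, 'm) category_scheme \<Rightarrow> 'o \<Rightarrow> 'o \<Rightarrow> 'a set" where
  "hom C A B = {f \<in> arr C. src C f = A \<and> tgt C f = B}"

locale category =
  fixes C :: "('o, 'a, 'm) category_scheme" (structure)
  assumes src_obj: "f \<in> arr C \<Longrightarrow> src C f \<in> obj C"
    and tgt_obj: "f \<in> arr C \<Longrightarrow> tgt C f \<in> obj C"
    and ide_hom: "A \<in> obj C \<Longrightarrow> ide C A \<in> hom C A A"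
    and cmp_hom: "\<lbrakk>f \<in> hom C A B; g \<in> hom C B D\<rbrakk> \<Longrightarrow> g \<cdot> f \<in> hom C A D"
    and cmp_ide_right: "f \<in> hom C A B \<Longrightarrow> f \<cdot> ide C A = f"
    and cmp_ide_left: "f \<in> hom C A B \<Longrightarrow> ide C B \<cdot> f = f"
    and cmp_assoc:
      "\<lbrakk>f \<in> hom C A B; g \<in> hom C B D; h \<in> hom C D E\<rbrakk> \<Longrightarrow> (h \<cdot> g) \<cdot> f = h \<cdot> (g \<cdot> f)"

definition is_terminal :: "('o, 'a, 'm) category_scheme \<Rightarrow> 'o \<Rightarrow> bool" where
  "is_terminal C T \<longleftrightarrow> T \<in> obj C \<and> (\<forall>A\<in>obj C. \<exists>!f. f \<in> hom C A T)"

definition is_product ::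
    "('o, 'a, 'm) category_scheme \<Rightarrow> 'o \<Rightarrow> 'o \<Rightarrow> 'o \<Rightarrow> 'a \<Rightarrow> 'a \<Rightarrow> bool" where
  "is_product C A B Q p q \<longleftrightarrow>
     p \<in> hom C Q A \<and> q \<in> hom C Q B \<and>
     (\<forall>Z f g. f \<in> hom C Z A \<and> g \<in> hom C Z B \<longrightarrow>
        (\<exists>!h. h \<in> hom C Z Q \<and> p \<cdot>\<^bsub>C\<^esub> h = f \<and> q \<cdot>\<^bsub>C\<^esub> h = g))"

text \<open>The first leg of an arbitrary product cone, not only of a chosen one.  Second legs are
  covered as well, because \<^const>\<open>is_product\<close> is symmetric in the two factors.\<close>
definition is_projection :: "('o, 'a, 'm) category_scheme \<Rightarrow> 'a \<Rightarrow> bool" where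
  "is_projection C p \<longleftrightarrow> (\<exists>A B Q q. is_product C A B Q p q)"

text \<open>The pullback square \<open>f \<cdot> h = g \<cdot> k\<close>.\<close>
definition is_pullback ::
    "('o, 'a, 'm) category_scheme \<Rightarrow> 'a \<Rightarrow> 'a \<Rightarrow> 'a \<Rightarrow> 'a \<Rightarrow> bool" where
  "is_pullback C f g h k \<longleftrightarrow>
     (\<exists>A B D E. f \<in> hom C A B \<and> g \<in> hom C D B \<and> h \<in> hom C E A \<and> k \<in> hom C E D \<and>
        f \<cdot>\<^bsub>C\<^esub> h = g \<cdot>\<^bsub>C\<^esub> k \<and>
        (\<forall>Z h' k'. h' \<in> hom C Z A \<and> k' \<in> hom C Z D \<and> f \<cdot>\<^bsub>C\<^esub> h' = g \<cdot>\<^bsub>C\<^esub> k' \<longrightarrow>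
           (\<exists>!u. u \<in> hom C Z E \<and> h \<cdot>\<^bsub>C\<^esub> u = h' \<and> k \<cdot>\<^bsub>C\<^esub> u = k')))"

text \<open>A choice of binary products is part of the structure, so that contexts such as
  \<open>(I \<otimes> U) \<otimes> X\<close> denote objects.\<close>
record ('o, 'a) cartesian = "('o, 'a) category" +
  prd :: "'o \<Rightarrow> 'o \<Rightarrow> 'o"  (infixl \<open>\<otimes>\<index>\<close> 70)
  pr1 :: "'o \<Rightarrow> 'o \<Rightarrow> 'a"
  pr2 :: "'o \<Rightarrow> 'o \<Rightarrow> 'a"

locale cartesian_category = category C
  for C :: "('o, 'a, 'm) cartesian_scheme" (structure) +
  assumes terminal_exists: "\<exists>T. is_terminal C T"
    and chosen_product:
      "\<lbrakk>A \<in> obj C; B \<in> obj C\<rbrakk> \<Longrightarrow> is_product C A B (A \<otimes> B) (pr1 C A B) (pr2 C A B)"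

definition pair :: "('o, 'a, 'm) cartesian_scheme \<Rightarrow> 'a \<Rightarrow> 'a \<Rightarrow> 'a"
    (\<open>(\<langle>_,/ _\<rangle>\<index>)\<close>) where
  "\<langle>f, g\<rangle>\<^bsub>C\<^esub> =
     (THE h. h \<in> hom C (src C f) (tgt C f \<otimes>\<^bsub>C\<^esub> tgt C g) \<and>
             pr1 C (tgt C f) (tgt C g) \<cdot>\<^bsub>C\<^esub> h = f \<and> pr2 C (tgt C f) (tgt C g) \<cdot>\<^bsub>C\<^esub> h = g)"

text \<open>\<open>E\<close> is the exponential \<open>B\<^sup>A\<close>, with evaluation \<open>ev : E \<otimes> A \<rightarrow> B\<close>.\<close>
definition is_exponential ::
    "('o, 'a, 'm) cartesian_scheme \<Rightarrow> 'o \<Rightarrow> 'o \<Rightarrow> 'o \<Rightarrow> 'a \<Rightarrow> bool" where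
  "is_exponential C A B E ev \<longleftrightarrow>
     A \<in> obj C \<and> B \<in> obj C \<and> E \<in> obj C \<and> ev \<in> hom C (E \<otimes>\<^bsub>C\<^esub> A) B \<and>
     (\<forall>Z\<in>obj C. \<forall>f\<in>hom C (Z \<otimes>\<^bsub>C\<^esub> A) B.
        \<exists>!g. g \<in> hom C Z E \<and> ev \<cdot>\<^bsub>C\<^esub> \<langle>g \<cdot>\<^bsub>C\<^esub> pr1 C Z A, pr2 C Z A\<rangle>\<^bsub>C\<^esub> = f)"

definition cartesian_closed :: "('o, 'a, 'm) cartesian_scheme \<Rightarrow> bool" where
  "cartesian_closed C \<longleftrightarrow>
     cartesian_category C \<and> (\<forall>A\<in>obj C. \<forall>B\<in>obj C. \<exists>E ev. is_exponential C A B E ev)"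


section \<open>Heyting algebras\<close>

definition himp :: "('p, 'm) gorder_scheme \<Rightarrow> 'p \<Rightarrow> 'p \<Rightarrow> 'p" where
  "himp L a b = (SOME c. greatest L c {x \<in> carrier L. x \<sqinter>\<^bsub>L\<^esub> a \<sqsubseteq>\<^bsub>L\<^esub> b})"

locale heyting_algebra = bounded_lattice L
  for L :: "('p, 'm) gorder_scheme" (structure) +
  assumes himp_exists:
    "\<lbrakk>a \<in> carrier L; b \<in> carrier L\<rbrakk> \<Longrightarrow> \<exists>c. greatest L c {x \<in> carrier L. x \<sqinter> a \<sqsubseteq> b}"

definition heyting_hom ::
    "('p, 'm) gorder_scheme \<Rightarrow> ('q, 'n) gorder_scheme \<Rightarrow> ('p \<Rightarrow> 'q) \<Rightarrow> bool" where
  "heyting_hom L M h \<longleftrightarrow>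
     heyting_algebra L \<and> heyting_algebra M \<and> h \<in> carrier L \<rightarrow> carrier M \<and>
     h \<top>\<^bsub>L\<^esub> = \<top>\<^bsub>M\<^esub> \<and> h \<bottom>\<^bsub>L\<^esub> = \<bottom>\<^bsub>M\<^esub> \<and> meet_pres L M h \<and> join_pres L M h \<and>
     (\<forall>a\<in>carrier L. \<forall>b\<in>carrier L. h (himp L a b) = himp M (h a) (h b))"


section \<open>Doctrines and quantifiers\<close>

text \<open>\<open>fibre P A\<close> is \<open>P(A)\<close> and \<open>rx P f\<close> is the reindexing \<open>P\<^sub>f\<close>.  The fibres are orders on
  subsets of one type; fibres over distinct objects may overlap, since \<open>P\<^sub>f\<close> depends on \<open>f\<close> and hence
  on its source and target.\<close>
record ('o, 'a, 'p) doctrine_data =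
  fibre :: "'o \<Rightarrow> 'p gorder"
  rx :: "'a \<Rightarrow> 'p \<Rightarrow> 'p"

locale doctrine = cartesian_category C
  for C :: "('o, 'a, 'm) cartesian_scheme" (structure)
    and P :: "('o, 'a, 'p) doctrine_data" +
  assumes fibre_order: "A \<in> obj C \<Longrightarrow> partial_order (fibre P A)"
    and rx_closed: "f \<in> hom C A B \<Longrightarrow> rx P f \<in> carrier (fibre P B) \<rightarrow> carrier (fibre P A)"
    and rx_mono: "f \<in> hom C A B \<Longrightarrow> isotone (fibre P B) (fibre P A) (rx P f)"
    and rx_ide: "\<lbrakk>A \<in> obj C; \<alpha> \<in> carrier (fibre P A)\<rbrakk> \<Longrightarrow> rx P (ide C A) \<alpha> = \<alpha>"
    and rx_cmp: "\<lbrakk>f \<in> hom C A B; g \<in> hom C B D; \<alpha> \<in> carrier (fibre P D)\<rbrakk>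
                  \<Longrightarrow> rx P (g \<cdot> f) \<alpha> = rx P f (rx P g \<alpha>)"

definition is_left_adjoint ::
    "('o, 'a, 'm) cartesian_scheme \<Rightarrow> ('o, 'a, 'p) doctrine_data \<Rightarrow> 'a \<Rightarrow> ('p \<Rightarrow> 'p) \<Rightarrow> bool" where
  "is_left_adjoint C P f e \<longleftrightarrow>
     galois_connection \<lparr>orderA = fibre P (src C f), orderB = fibre P (tgt C f),
                        lower = e, upper = rx P f\<rparr>"

definition is_right_adjoint ::
    "('o, 'a, 'm) cartesian_scheme \<Rightarrow> ('o, 'a, 'p) doctrine_data \<Rightarrow> 'a \<Rightarrow> ('p \<Rightarrow> 'p) \<Rightarrow> bool" where
  "is_right_adjoint C P f u \<longleftrightarrow>
     galois_connection \<lparr>orderA = fibre P (tgt C f), orderB = fibre P (src C f),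
                        lower = rx P f, upper = u\<rparr>"

text \<open>\<open>\<exists>\<^sub>f\<close> and \<open>\<forall>\<^sub>f\<close>.  Adjoints between posets are unique, so when an adjoint exists the choice only
  concerns values outside the carrier.\<close>
definition exq ::
    "('o, 'a, 'm) cartesian_scheme \<Rightarrow> ('o, 'a, 'p) doctrine_data \<Rightarrow> 'a \<Rightarrow> 'p \<Rightarrow> 'p" where
  "exq C P f = (SOME e. is_left_adjoint C P f e)"

definition allq ::
    "('o, 'a, 'm) cartesian_scheme \<Rightarrow> ('o, 'a, 'p) doctrine_data \<Rightarrow> 'a \<Rightarrow> 'p \<Rightarrow> 'p" where
  "allq C P f = (SOME u. is_right_adjoint C P f u)"

definition bc_ex ::
    "('o, 'a, 'm) cartesian_scheme \<Rightarrow> ('o, 'a, 'p) doctrine_data \<Rightarrow> 'a \<Rightarrow> 'a \<Rightarrow> 'a \<Rightarrow> 'a \<Rightarrow> bool" where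
  "bc_ex C P f g h k \<longleftrightarrow>
     (\<forall>\<beta>\<in>carrier (fibre P (src C f)). exq C P k (rx P h \<beta>) = rx P g (exq C P f \<beta>))"

definition bc_all ::
    "('o, 'a, 'm) cartesian_scheme \<Rightarrow> ('o, 'a, 'p) doctrine_data \<Rightarrow> 'a \<Rightarrow> 'a \<Rightarrow> 'a \<Rightarrow> 'a \<Rightarrow> bool" where
  "bc_all C P f g h k \<longleftrightarrow>
     (\<forall>\<beta>\<in>carrier (fibre P (src C f)). allq C P k (rx P h \<beta>) = rx P g (allq C P f \<beta>))"

locale existential_doctrine = doctrine C P
  for C :: "('o, 'a, 'm) cartesian_scheme" (structure)
    and P :: "('o, 'a, 'p) doctrine_data" +
  assumes ex_adjoint: "is_projection C p \<Longrightarrow> \<exists>e. is_left_adjoint C P p e"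
    and ex_beck_chevalley:
      "\<lbrakk>is_projection C p; is_projection C p'; is_pullback C p f f' p'\<rbrakk> \<Longrightarrow> bc_ex C P p f f' p'"

locale universal_doctrine = doctrine C P
  for C :: "('o, 'a, 'm) cartesian_scheme" (structure)
    and P :: "('o, 'a, 'p) doctrine_data" +
  assumes all_adjoint: "is_projection C p \<Longrightarrow> \<exists>u. is_right_adjoint C P p u"
    and all_beck_chevalley:
      "\<lbrakk>is_projection C p; is_projection C p'; is_pullback C p f f' p'\<rbrakk> \<Longrightarrow> bc_all C P p f f' p'"

locale first_order_hyperdoctrine = doctrine C P
  for C :: "('o, 'a, 'm) cartesian_scheme" (structure)
    and P :: "('o, 'a, 'p) doctrine_data" +
  assumes fibre_heyting: "A \<in> obj C \<Longrightarrow> heyting_algebra (fibre P A)"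
    and rx_heyting: "f \<in> hom C A B \<Longrightarrow> heyting_hom (fibre P B) (fibre P A) (rx P f)"
    and left_adjoint: "f \<in> arr C \<Longrightarrow> \<exists>e. is_left_adjoint C P f e"
    and right_adjoint: "f \<in> arr C \<Longrightarrow> \<exists>u. is_right_adjoint C P f u"
    and beck_chevalley_ex: "is_pullback C f g h k \<Longrightarrow> bc_ex C P f g h k"
    and beck_chevalley_all: "is_pullback C f g h k \<Longrightarrow> bc_all C P f g h k"


section \<open>Existential-free and universal-free predicates\<close>

definition ex_splitting ::
    "('o, 'a, 'm) cartesian_scheme \<Rightarrow> ('o, 'a, 'p) doctrine_data \<Rightarrow> 'o \<Rightarrow> 'p \<Rightarrow> bool" where
  "ex_splitting C P A \<alpha> \<longleftrightarrow>
     \<alpha> \<in> carrier (fibre P A) \<and>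
     (\<forall>B\<in>obj C. \<forall>\<beta>\<in>carrier (fibre P (A \<otimes>\<^bsub>C\<^esub> B)).
        \<alpha> \<sqsubseteq>\<^bsub>fibre P A\<^esub> exq C P (pr1 C A B) \<beta> \<longrightarrow>
        (\<exists>g\<in>hom C A B. \<alpha> \<sqsubseteq>\<^bsub>fibre P A\<^esub> rx P \<langle>ide C A, g\<rangle>\<^bsub>C\<^esub> \<beta>))"

definition ex_free ::
    "('o, 'a, 'm) cartesian_scheme \<Rightarrow> ('o, 'a, 'p) doctrine_data \<Rightarrow> 'o \<Rightarrow> 'p \<Rightarrow> bool" where
  "ex_free C P I \<alpha> \<longleftrightarrow>
     \<alpha> \<in> carrier (fibre P I) \<and> (\<forall>A. \<forall>f\<in>hom C A I. ex_splitting C P A (rx P f \<alpha>))"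

definition enough_ex_free ::
    "('o, 'a, 'm) cartesian_scheme \<Rightarrow> ('o, 'a, 'p) doctrine_data \<Rightarrow> bool" where
  "enough_ex_free C P \<longleftrightarrow>
     (\<forall>I\<in>obj C. \<forall>\<alpha>\<in>carrier (fibre P I).
        \<exists>A\<in>obj C. \<exists>\<beta>. ex_free C P (I \<otimes>\<^bsub>C\<^esub> A) \<beta> \<and> \<alpha> = exq C P (pr1 C I A) \<beta>)"

definition all_splitting ::
    "('o, 'a, 'm) cartesian_scheme \<Rightarrow> ('o, 'a, 'p) doctrine_data \<Rightarrow> 'o \<Rightarrow> 'p \<Rightarrow> bool" where
  "all_splitting C P A \<alpha> \<longleftrightarrow>
     \<alpha> \<in> carrier (fibre P A) \<and>
     (\<forall>B\<in>obj C. \<forall>\<beta>\<in>carrier (fibre P (A \<otimes>\<^bsub>C\<^esub> B)).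
        allq C P (pr1 C A B) \<beta> \<sqsubseteq>\<^bsub>fibre P A\<^esub> \<alpha> \<longrightarrow>
        (\<exists>g\<in>hom C A B. rx P \<langle>ide C A, g\<rangle>\<^bsub>C\<^esub> \<beta> \<sqsubseteq>\<^bsub>fibre P A\<^esub> \<alpha>))"

definition all_free ::
    "('o, 'a, 'm) cartesian_scheme \<Rightarrow> ('o, 'a, 'p) doctrine_data \<Rightarrow> 'o \<Rightarrow> 'p \<Rightarrow> bool" where
  "all_free C P I \<alpha> \<longleftrightarrow>
     \<alpha> \<in> carrier (fibre P I) \<and> (\<forall>A. \<forall>f\<in>hom C A I. all_splitting C P A (rx P f \<alpha>))"

definition enough_all_free ::
    "('o, 'a, 'm) cartesian_scheme \<Rightarrow> ('o, 'a, 'p) doctrine_data \<Rightarrow> bool" where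
  "enough_all_free C P \<longleftrightarrow>
     (\<forall>I\<in>obj C. \<forall>\<alpha>\<in>carrier (fibre P I).
        \<exists>A\<in>obj C. \<exists>\<beta>. all_free C P (I \<otimes>\<^bsub>C\<^esub> A) \<beta> \<and> \<alpha> = allq C P (pr1 C I A) \<beta>)"

definition ex_free_subdoctrine ::
    "('o, 'a, 'm) cartesian_scheme \<Rightarrow> ('o, 'a, 'p) doctrine_data \<Rightarrow> ('o, 'a, 'p) doctrine_data" where
  "ex_free_subdoctrine C P =
     \<lparr>fibre = (\<lambda>A. (fibre P A)\<lparr>carrier := {\<alpha>. ex_free C P A \<alpha>}\<rparr>), rx = rx P\<rparr>"

locale skolem_doctrine = existential_doctrine C P + universal_doctrine C P
  for C :: "('o, 'a, 'm) cartesian_scheme" (structure)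
    and P :: "('o, 'a, 'p) doctrine_data" +
  assumes base_cartesian_closed: "cartesian_closed C"
    and enough_existential_free: "enough_ex_free C P"
    and all_ex_free:
      "\<lbrakk>is_projection C p; ex_free C P (src C p) \<alpha>\<rbrakk> \<Longrightarrow> ex_free C P (tgt C p) (allq C P p \<alpha>)"

locale goedel_doctrine = skolem_doctrine C P
  for C :: "('o, 'a, 'm) cartesian_scheme" (structure)
    and P :: "('o, 'a, 'p) doctrine_data" +
  assumes enough_universal_free: "enough_all_free C (ex_free_subdoctrine C P)"

definition quantifier_free ::
    "('o, 'a, 'm) cartesian_scheme \<Rightarrow> ('o, 'a, 'p) doctrine_data \<Rightarrow> 'o \<Rightarrow> 'p \<Rightarrow> bool" where
  "quantifier_free C P A \<alpha> \<longleftrightarrow> ex_free C P A \<alpha> \<and> all_free C (ex_free_subdoctrine C P) A \<alpha>"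

locale goedel_first_order_hyperdoctrine = first_order_hyperdoctrine C P + goedel_doctrine C P
  for C :: "('o, 'a, 'm) cartesian_scheme" (structure)
    and P :: "('o, 'a, 'p) doctrine_data"

end

theory Submission
  imports Defs
begin

text \<open>
  Entailment can be tested on existential-free predicates \<open>\<delta>\<close> over arbitrary objects, because every
  predicate is an existential quantification of one of these.  For such \<open>\<delta>\<close>, existential quantifiers
  have witnesses, so the test reads as a Kripke--Joyal semantics in which the right-to-left entailment
  is immediate.

  For the converse, \<open>\<delta> \<and> \<forall>x. \<psi>\<close> is existential-free, so the conclusion \<open>\<exists>v. \<forall>y. \<phi>\<close> has a witness
  \<open>g\<^sub>0\<close>.  Write \<open>\<delta> = \<forall>b. \<gamma>\<close> with \<open>\<gamma>\<close> existential-free.  Falsehood is an existential splitting, so there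
  are arrows between any two objects and hence \<open>\<forall>b x. (\<gamma> \<and> \<psi>)\<close> entails \<open>(\<forall>b. \<gamma>) \<and> (\<forall>x. \<psi>)\<close>.  It
  therefore entails the universal-free predicate \<open>\<phi>(g\<^sub>0, y)\<close>, which gives \<open>g\<^sub>b\<close> and \<open>g\<^sub>1\<close> such that
  \<open>\<gamma>(g\<^sub>b) \<and> \<psi>(g\<^sub>1)\<close> entails \<open>\<phi>(g\<^sub>0, y)\<close>.  Since \<open>\<delta>\<close> entails \<open>\<gamma>(g\<^sub>b)\<close>, currying \<open>g\<^sub>0\<close> and \<open>g\<^sub>1\<close> yields
  the required witnesses \<open>f\<^sub>0\<close> and \<open>f\<^sub>1\<close>.
\<close>

section \<open>Finite products\<close>

lemma hom_iff: "f \<in> hom C A B \<longleftrightarrow> f \<in> arr C \<and> src C f = A \<and> tgt C f = B"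
  by (simp add: hom_def)

context category
begin

lemma ide_arr [simp]:
  assumes "A \<in> obj C"
  shows "ide C A \<in> arr C" "src C (ide C A) = A" "tgt C (ide C A) = A"
  using ide_hom[OF assms] by (auto simp: hom_iff)

lemma cmp_arr [simp]:
  assumes "f \<in> arr C" "g \<in> arr C" "tgt C f = src C g"
  shows "g \<cdot> f \<in> arr C" "src C (g \<cdot> f) = src C f" "tgt C (g \<cdot> f) = tgt C g"
  using cmp_hom[of f "src C f" "src C g" g "tgt C g"] assms by (auto simp: hom_iff)

lemma cmp_ide [simp]:
  assumes "f \<in> arr C"
  shows "src C f = A \<Longrightarrow> f \<cdot> ide C A = f" "tgt C f = A \<Longrightarrow> ide C A \<cdot> f = f"
  using cmp_ide_right cmp_ide_left assms by (auto simp: hom_iff)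

lemma assoc [simp]:
  assumes "f \<in> arr C" "g \<in> arr C" "h \<in> arr C" "tgt C f = src C g" "tgt C g = src C h"
  shows "(h \<cdot> g) \<cdot> f = h \<cdot> (g \<cdot> f)"
  using cmp_assoc[of f "src C f" "src C g" g "src C h" h "tgt C h"] assms by (auto simp: hom_iff)

declare src_obj [simp] tgt_obj [simp]

end

section \<open>Pairing, weakening squares and currying\<close>

context cartesian_category
begin

lemma pr_arr [simp]:
  assumes "A \<in> obj C" "B \<in> obj C"
  shows "pr1 C A B \<in> arr C" "src C (pr1 C A B) = A \<otimes> B" "tgt C (pr1 C A B) = A"
    "pr2 C A B \<in> arr C" "src C (pr2 C A B) = A \<otimes> B" "tgt C (pr2 C A B) = B"
  using chosen_product[OF assms] by (auto simp: is_product_def hom_iff)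

lemma prd_obj [simp]:
  assumes "A \<in> obj C" "B \<in> obj C"
  shows "A \<otimes> B \<in> obj C"
  using src_obj[of "pr1 C A B"] assms by simp

lemma pr_projection [simp]:
  assumes "A \<in> obj C" "B \<in> obj C"
  shows "is_projection C (pr1 C A B)"
  using chosen_product[OF assms] by (auto simp: is_projection_def)

lemma pair_ex1:
  assumes "f \<in> arr C" "g \<in> arr C" "src C f = src C g"
  shows "\<exists>!h. h \<in> hom C (src C f) (tgt C f \<otimes> tgt C g) \<and>
    pr1 C (tgt C f) (tgt C g) \<cdot> h = f \<and> pr2 C (tgt C f) (tgt C g) \<cdot> h = g"
proof -
  have "is_product C (tgt C f) (tgt C g) (tgt C f \<otimes> tgt C g)
      (pr1 C (tgt C f) (tgt C g)) (pr2 C (tgt C f) (tgt C g))"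
    using assms by (simp add: chosen_product)
  moreover have "f \<in> hom C (src C f) (tgt C f)" "g \<in> hom C (src C f) (tgt C g)"
    using assms by (auto simp: hom_iff)
  ultimately show ?thesis
    unfolding is_product_def by blast
qed

lemma pair_props:
  assumes "f \<in> arr C" "g \<in> arr C" "src C f = src C g"
  shows "\<langle>f, g\<rangle> \<in> hom C (src C f) (tgt C f \<otimes> tgt C g) \<and>
    pr1 C (tgt C f) (tgt C g) \<cdot> \<langle>f, g\<rangle> = f \<and> pr2 C (tgt C f) (tgt C g) \<cdot> \<langle>f, g\<rangle> = g"
  by (rule theI'[OF pair_ex1[OF assms], folded pair_def])

lemma pair_arr [simp]:
  assumes "f \<in> arr C" "g \<in> arr C" "src C f = src C g"
  shows "\<langle>f, g\<rangle> \<in> arr C" "src C \<langle>f, g\<rangle> = src C g" "tgt C \<langle>f, g\<rangle> = tgt C f \<otimes> tgt C g"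
  using pair_props[OF assms] assms by (auto simp: hom_iff)

lemma pr_pair [simp]:
  assumes "f \<in> arr C" "g \<in> arr C" "src C f = src C g" "tgt C f = A" "tgt C g = B"
  shows "pr1 C A B \<cdot> \<langle>f, g\<rangle> = f" "pr2 C A B \<cdot> \<langle>f, g\<rangle> = g"
  using pair_props[OF assms(1-3)] assms by auto

text \<open>Joint monicity of the projections: both arrows solve the same product problem, whose
  solution is unique.\<close>

lemma pair_eqI:
  assumes "h \<in> arr C" "k \<in> arr C" "src C h = src C k" "tgt C h = A \<otimes> B" "tgt C k = A \<otimes> B"
    and "A \<in> obj C" "B \<in> obj C"
    and "pr1 C A B \<cdot> h = pr1 C A B \<cdot> k" "pr2 C A B \<cdot> h = pr2 C A B \<cdot> k"
  shows "h = k"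
proof -
  have "\<exists>!h'. h' \<in> hom C (src C k) (A \<otimes> B) \<and>
      pr1 C A B \<cdot> h' = pr1 C A B \<cdot> k \<and> pr2 C A B \<cdot> h' = pr2 C A B \<cdot> k"
    using pair_ex1[of "pr1 C A B \<cdot> k" "pr2 C A B \<cdot> k"] assms(1-7) by simp
  then obtain m where unique: "\<And>h'. h' \<in> hom C (src C k) (A \<otimes> B) \<and>
      pr1 C A B \<cdot> h' = pr1 C A B \<cdot> k \<and> pr2 C A B \<cdot> h' = pr2 C A B \<cdot> k \<Longrightarrow> h' = m"
    by (elim ex1E) blast
  have "h = m"
    by (rule unique) (use assms in \<open>simp add: hom_iff\<close>)
  moreover have "k = m"
    by (rule unique) (use assms in \<open>simp add: hom_iff\<close>)
  ultimately show ?thesis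
    by simp
qed

lemma pair_cmp [simp]:
  assumes "f \<in> arr C" "g \<in> arr C" "src C f = src C g" "k \<in> arr C" "tgt C k = src C g"
  shows "\<langle>f, g\<rangle> \<cdot> k = \<langle>f \<cdot> k, g \<cdot> k\<rangle>"
proof (rule pair_eqI[where A = "tgt C f" and B = "tgt C g"])
  show "pr1 C (tgt C f) (tgt C g) \<cdot> (\<langle>f, g\<rangle> \<cdot> k) = pr1 C (tgt C f) (tgt C g) \<cdot> \<langle>f \<cdot> k, g \<cdot> k\<rangle>"
    using assms by (simp add: assoc[symmetric] del: assoc)
  show "pr2 C (tgt C f) (tgt C g) \<cdot> (\<langle>f, g\<rangle> \<cdot> k) = pr2 C (tgt C f) (tgt C g) \<cdot> \<langle>f \<cdot> k, g \<cdot> k\<rangle>"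
    using assms by (simp add: assoc[symmetric] del: assoc)
qed (use assms in simp_all)

lemma pair_eta:
  assumes "h \<in> arr C" "tgt C h = A \<otimes> B" "A \<in> obj C" "B \<in> obj C"
  shows "\<langle>pr1 C A B \<cdot> h, pr2 C A B \<cdot> h\<rangle> = h"
  by (rule pair_eqI[where A = A and B = B]) (use assms in simp_all)

lemma pair_pr [simp]:
  assumes "A \<in> obj C" "B \<in> obj C"
  shows "\<langle>pr1 C A B, pr2 C A B\<rangle> = ide C (A \<otimes> B)"
  using pair_eta[of "ide C (A \<otimes> B)" A B] assms by simp

text \<open>The mediating arrow is forced: its first component is \<open>k'\<close>, and its second
  is that of \<open>h'\<close> because \<open>h\<close> leaves the variable of type \<open>B\<close>
  alone. This is the square at which Beck-Chevalley is used, for substitution along \<open>h\<close>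
  under a quantifier over \<open>B\<close>.\<close>

lemma weakening_pullback:
  assumes "h \<in> arr C" "B \<in> obj C"
  shows "is_pullback C (pr1 C (tgt C h) B) h
    \<langle>h \<cdot> pr1 C (src C h) B, pr2 C (src C h) B\<rangle> (pr1 C (src C h) B)"
  unfolding is_pullback_def
proof (intro exI conjI allI impI)
  let ?A = "tgt C h" and ?Z = "src C h"
  fix W h' k'
  assume *: "h' \<in> hom C W (?A \<otimes> B) \<and> k' \<in> hom C W ?Z \<and> pr1 C ?A B \<cdot> h' = h \<cdot> k'"
  then have h': "h' \<in> arr C" "src C h' = W" "tgt C h' = ?A \<otimes> B"
    and k': "k' \<in> arr C" "src C k' = W" "tgt C k' = ?Z"
    and eq: "pr1 C ?A B \<cdot> h' = h \<cdot> k'"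
    by (auto simp: hom_iff)
  show "\<exists>!u. u \<in> hom C W (?Z \<otimes> B) \<and>
      \<langle>h \<cdot> pr1 C ?Z B, pr2 C ?Z B\<rangle> \<cdot> u = h' \<and> pr1 C ?Z B \<cdot> u = k'"
  proof (rule ex1I[where a = "\<langle>k', pr2 C ?A B \<cdot> h'\<rangle>"])
    show "\<langle>k', pr2 C ?A B \<cdot> h'\<rangle> \<in> hom C W (?Z \<otimes> B) \<and>
        \<langle>h \<cdot> pr1 C ?Z B, pr2 C ?Z B\<rangle> \<cdot> \<langle>k', pr2 C ?A B \<cdot> h'\<rangle> = h' \<and>
        pr1 C ?Z B \<cdot> \<langle>k', pr2 C ?A B \<cdot> h'\<rangle> = k'"
      using assms h' k' pair_eta[of h' ?A B] by (simp add: hom_iff eq[symmetric])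
    fix u
    assume u: "u \<in> hom C W (?Z \<otimes> B) \<and>
      \<langle>h \<cdot> pr1 C ?Z B, pr2 C ?Z B\<rangle> \<cdot> u = h' \<and> pr1 C ?Z B \<cdot> u = k'"
    then have "pr2 C ?A B \<cdot> h' = pr2 C ?Z B \<cdot> u"
      using assms by (auto simp: hom_iff)
    then show "u = \<langle>k', pr2 C ?A B \<cdot> h'\<rangle>"
      using u assms pair_eta[of u ?Z B] by (auto simp: hom_iff)
  qed
qed (use assms in \<open>auto simp: hom_iff\<close>)

text \<open>Precomposing the defining equation of the transpose with
  \<open>\<langle>k, a\<rangle>\<close> gives its evaluation at arbitrary generalised elements, not
  only at the two projections.\<close>

lemma curry_ex:
  assumes "is_exponential C A B E ev" "Z \<in> obj C" "f \<in> arr C" "src C f = Z \<otimes> A" "tgt C f = B"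
  obtains g where "g \<in> arr C" "src C g = Z" "tgt C g = E"
    "\<And>k a. k \<in> arr C \<Longrightarrow> a \<in> arr C \<Longrightarrow> tgt C k = Z \<Longrightarrow> tgt C a = A \<Longrightarrow> src C k = src C a \<Longrightarrow>
      ev \<cdot> \<langle>g \<cdot> k, a\<rangle> = f \<cdot> \<langle>k, a\<rangle>"
proof -
  from assms obtain g where g: "g \<in> arr C" "src C g = Z" "tgt C g = E"
    and eq: "ev \<cdot> \<langle>g \<cdot> pr1 C Z A, pr2 C Z A\<rangle> = f"
    unfolding is_exponential_def by (fastforce simp: hom_iff)
  have [simp]: "A \<in> obj C" "E \<in> obj C" and ev: "ev \<in> arr C" "src C ev = E \<otimes> A"
    using assms(1) by (auto simp: is_exponential_def hom_iff)
  show ?thesis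
  proof (rule that[OF g])
    fix k a
    assume *: "k \<in> arr C" "a \<in> arr C" "tgt C k = Z" "tgt C a = A" "src C k = src C a"
    have "(ev \<cdot> \<langle>g \<cdot> pr1 C Z A, pr2 C Z A\<rangle>) \<cdot> \<langle>k, a\<rangle> = ev \<cdot> \<langle>g \<cdot> k, a\<rangle>"
      using * g ev assms(2) by simp
    then show "ev \<cdot> \<langle>g \<cdot> k, a\<rangle> = f \<cdot> \<langle>k, a\<rangle>"
      by (simp only: eq)
  qed
qed

end

section \<open>Reindexing and quantifiers\<close>

context doctrine
begin

abbreviation entails :: "'p \<Rightarrow> 'o \<Rightarrow> 'p \<Rightarrow> bool" (\<open>(_ \<turnstile>\<^bsub>_\<^esub> _)\<close> [51, 0, 51] 50) where
  "\<alpha> \<turnstile>\<^bsub>A\<^esub> \<beta> \<equiv> \<alpha> \<sqsubseteq>\<^bsub>fibre P A\<^esub> \<beta>"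

lemma rx_carrier [simp]:
  assumes "f \<in> arr C" "src C f = A" "\<alpha> \<in> carrier (fibre P (tgt C f))"
  shows "rx P f \<alpha> \<in> carrier (fibre P A)"
  using rx_closed[of f A "tgt C f"] assms by (auto simp: hom_iff)

lemma rx_rx [simp]:
  assumes "f \<in> arr C" "g \<in> arr C" "tgt C f = src C g" "\<alpha> \<in> carrier (fibre P (tgt C g))"
  shows "rx P f (rx P g \<alpha>) = rx P (g \<cdot> f) \<alpha>"
  using rx_cmp[of f "src C f" "src C g" g "tgt C g" \<alpha>] assms by (auto simp: hom_iff)

declare rx_ide [simp]

lemma rx_entails:
  assumes "\<alpha> \<turnstile>\<^bsub>A\<^esub> \<beta>" "f \<in> arr C" "tgt C f = A"
    and "\<alpha> \<in> carrier (fibre P A)" "\<beta> \<in> carrier (fibre P A)" "src C f = Z"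
  shows "rx P f \<alpha> \<turnstile>\<^bsub>Z\<^esub> rx P f \<beta>"
  using rx_mono[of f Z A] assms by (auto simp: hom_iff isotone_def)

lemma entails_refl [simp]: "A \<in> obj C \<Longrightarrow> \<alpha> \<in> carrier (fibre P A) \<Longrightarrow> \<alpha> \<turnstile>\<^bsub>A\<^esub> \<alpha>"
  using fibre_order partial_order.axioms(1) weak_partial_order.le_refl by metis

lemma entails_trans:
  assumes "\<alpha> \<turnstile>\<^bsub>A\<^esub> \<beta>" "\<beta> \<turnstile>\<^bsub>A\<^esub> \<gamma>" "A \<in> obj C"
    and "\<alpha> \<in> carrier (fibre P A)" "\<beta> \<in> carrier (fibre P A)" "\<gamma> \<in> carrier (fibre P A)"
  shows "\<alpha> \<turnstile>\<^bsub>A\<^esub> \<gamma>"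
proof -
  interpret partial_order "fibre P A"
    by (rule fibre_order) fact
  show ?thesis
    using le_trans assms by blast
qed

lemma entails_antisym:
  assumes "\<alpha> \<turnstile>\<^bsub>A\<^esub> \<beta>" "\<beta> \<turnstile>\<^bsub>A\<^esub> \<alpha>" "A \<in> obj C" "\<alpha> \<in> carrier (fibre P A)" "\<beta> \<in> carrier (fibre P A)"
  shows "\<alpha> = \<beta>"
proof -
  interpret partial_order "fibre P A"
    by (rule fibre_order) fact
  show ?thesis
    using le_antisym assms by blast
qed

lemma ex_free_carrier [simp]: "ex_free C P A \<alpha> \<Longrightarrow> \<alpha> \<in> carrier (fibre P A)"
  by (simp add: ex_free_def)

lemma ex_free_rx [simp]:
  assumes "ex_free C P (tgt C f) \<alpha>" "f \<in> arr C" "src C f = A"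
  shows "ex_free C P A (rx P f \<alpha>)"
  using assms unfolding ex_free_def by (auto simp: hom_iff)

text \<open>Freeness quantifies over all reindexings, and reindexing along \<open>f\<close> and then
  along \<open>g\<close> is reindexing along \<open>f \<cdot> g\<close>.\<close>

lemma all_free_subdoctrine_rx:
  assumes "all_free C (ex_free_subdoctrine C P) (tgt C f) \<alpha>" "f \<in> arr C" "src C f = A"
  shows "all_free C (ex_free_subdoctrine C P) A (rx P f \<alpha>)"
proof -
  have \<alpha>: "ex_free C P (tgt C f) \<alpha>"
    using assms(1) by (simp add: all_free_def ex_free_subdoctrine_def)
  have "all_splitting C (ex_free_subdoctrine C P) D (rx P g (rx P f \<alpha>))" if "g \<in> hom C D A" for D g
  proof -
    have "f \<cdot> g \<in> hom C D (tgt C f)" "rx P g (rx P f \<alpha>) = rx P (f \<cdot> g) \<alpha>"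
      using that assms \<alpha> by (auto simp: hom_iff)
    then show ?thesis
      using assms(1) unfolding all_free_def by (simp add: ex_free_subdoctrine_def)
  qed
  then show ?thesis
    using assms \<alpha> unfolding all_free_def by (simp add: ex_free_subdoctrine_def)
qed

end

section \<open>Existential quantifiers: introduction and extraction of witnesses\<close>

context existential_doctrine
begin

lemma exq_adjoint: "is_projection C p \<Longrightarrow> is_left_adjoint C P p (exq C P p)"
  unfolding exq_def by (rule someI_ex[OF ex_adjoint])

lemma exq_carrier [simp]:
  assumes "A \<in> obj C" "B \<in> obj C" "\<beta> \<in> carrier (fibre P (A \<otimes> B))"
  shows "exq C P (pr1 C A B) \<beta> \<in> carrier (fibre P A)"
proof -
  interpret galois_connection "\<lparr>orderA = fibre P (A \<otimes> B), orderB = fibre P A,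
      lower = exq C P (pr1 C A B), upper = rx P (pr1 C A B)\<rparr>"
    using exq_adjoint[of "pr1 C A B"] assms by (simp add: is_left_adjoint_def)
  show ?thesis
    using lower_closed assms by simp
qed

lemma exq_iff:
  assumes "A \<in> obj C" "B \<in> obj C" "\<beta> \<in> carrier (fibre P (A \<otimes> B))" "\<alpha> \<in> carrier (fibre P A)"
  shows "exq C P (pr1 C A B) \<beta> \<turnstile>\<^bsub>A\<^esub> \<alpha> \<longleftrightarrow> \<beta> \<turnstile>\<^bsub>A \<otimes> B\<^esub> rx P (pr1 C A B) \<alpha>"
proof -
  interpret galois_connection "\<lparr>orderA = fibre P (A \<otimes> B), orderB = fibre P A,
      lower = exq C P (pr1 C A B), upper = rx P (pr1 C A B)\<rparr>"
    using exq_adjoint[of "pr1 C A B"] assms by (simp add: is_left_adjoint_def)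
  show ?thesis
    using galois_property assms by simp
qed

lemma rx_exq:
  assumes "h \<in> arr C" "B \<in> obj C" "\<beta> \<in> carrier (fibre P (tgt C h \<otimes> B))"
  shows "rx P h (exq C P (pr1 C (tgt C h) B) \<beta>) = exq C P (pr1 C (src C h) B)
    (rx P \<langle>h \<cdot> pr1 C (src C h) B, pr2 C (src C h) B\<rangle> \<beta>)"
  using ex_beck_chevalley[OF _ _ weakening_pullback] assms by (simp add: bc_ex_def)

text \<open>The unit of the adjunction, reindexed along \<open>\<langle>h, g\<rangle>\<close>,
  because the first projection of this pair is \<open>h\<close>.\<close>

lemma entails_exI:
  assumes "\<delta> \<turnstile>\<^bsub>Z\<^esub> rx P \<langle>h, g\<rangle> \<beta>" "\<delta> \<in> carrier (fibre P Z)" "\<beta> \<in> carrier (fibre P (A \<otimes> B))"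
    and "h \<in> arr C" "src C h = Z" "tgt C h = A" "g \<in> arr C" "src C g = Z" "tgt C g = B"
  shows "\<delta> \<turnstile>\<^bsub>Z\<^esub> rx P h (exq C P (pr1 C A B) \<beta>)"
proof -
  have [simp]: "Z \<in> obj C" "A \<in> obj C" "B \<in> obj C"
    using assms by auto
  have "\<beta> \<turnstile>\<^bsub>A \<otimes> B\<^esub> rx P (pr1 C A B) (exq C P (pr1 C A B) \<beta>)"
    using assms exq_iff[of A B \<beta> "exq C P (pr1 C A B) \<beta>"] by simp
  then have "rx P \<langle>h, g\<rangle> \<beta> \<turnstile>\<^bsub>Z\<^esub> rx P \<langle>h, g\<rangle> (rx P (pr1 C A B) (exq C P (pr1 C A B) \<beta>))"
    by (rule rx_entails) (use assms in simp_all)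
  then have "rx P \<langle>h, g\<rangle> \<beta> \<turnstile>\<^bsub>Z\<^esub> rx P h (exq C P (pr1 C A B) \<beta>)"
    using assms by simp
  then show ?thesis
    by (rule entails_trans[OF assms(1)]) (use assms in simp_all)
qed

text \<open>An existential-free \<open>\<delta>\<close> is a splitting already at the identity
  arrow. This gives the existential clause of the forcing semantics without passing to a cover: the
  witness lives at the same stage \<open>Z\<close>.\<close>

lemma entails_exE:
  assumes "ex_free C P Z \<delta>" "\<delta> \<turnstile>\<^bsub>Z\<^esub> rx P h (exq C P (pr1 C A B) \<beta>)"
    and "\<beta> \<in> carrier (fibre P (A \<otimes> B))" "B \<in> obj C"
    and "h \<in> arr C" "src C h = Z" "tgt C h = A"
  obtains g where "g \<in> arr C" "src C g = Z" "tgt C g = B" "\<delta> \<turnstile>\<^bsub>Z\<^esub> rx P \<langle>h, g\<rangle> \<beta>"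
proof -
  have [simp]: "Z \<in> obj C" "A \<in> obj C"
    using assms by auto
  have "rx P (ide C Z) \<delta> = \<delta>"
    using assms by simp
  then have "ex_splitting C P Z \<delta>"
    using assms(1) ide_hom[of Z] unfolding ex_free_def by force
  \<comment> \<open>Beck-Chevalley moves the quantifier into the context \<open>Z\<close>, where the
    splitting property of \<open>\<delta>\<close> applies.\<close>
  moreover have "\<delta> \<turnstile>\<^bsub>Z\<^esub> exq C P (pr1 C Z B) (rx P \<langle>h \<cdot> pr1 C Z B, pr2 C Z B\<rangle> \<beta>)"
    using assms rx_exq[of h B \<beta>] by simp
  moreover have "rx P \<langle>h \<cdot> pr1 C Z B, pr2 C Z B\<rangle> \<beta> \<in> carrier (fibre P (Z \<otimes> B))"
    using assms by simp
  ultimately obtain g where "g \<in> hom C Z B"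
    and split: "\<delta> \<turnstile>\<^bsub>Z\<^esub> rx P \<langle>ide C Z, g\<rangle> (rx P \<langle>h \<cdot> pr1 C Z B, pr2 C Z B\<rangle> \<beta>)"
    using \<open>B \<in> obj C\<close> unfolding ex_splitting_def by blast
  then have g: "g \<in> arr C" "src C g = Z" "tgt C g = B"
    by (simp_all add: hom_iff)
  have "\<delta> \<turnstile>\<^bsub>Z\<^esub> rx P \<langle>h, g\<rangle> \<beta>"
    using split g assms by simp
  with g show ?thesis
    by (rule that)
qed

end

section \<open>Universal quantifiers as statements about all later stages\<close>

context universal_doctrine
begin

lemma allq_adjoint: "is_projection C p \<Longrightarrow> is_right_adjoint C P p (allq C P p)"
  unfolding allq_def by (rule someI_ex[OF all_adjoint])

lemma allq_carrier [simp]: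
  assumes "A \<in> obj C" "B \<in> obj C" "\<beta> \<in> carrier (fibre P (A \<otimes> B))"
  shows "allq C P (pr1 C A B) \<beta> \<in> carrier (fibre P A)"
proof -
  interpret galois_connection "\<lparr>orderA = fibre P A, orderB = fibre P (A \<otimes> B),
      lower = rx P (pr1 C A B), upper = allq C P (pr1 C A B)\<rparr>"
    using allq_adjoint[of "pr1 C A B"] assms by (simp add: is_right_adjoint_def)
  show ?thesis
    using upper_closed assms by simp
qed

lemma allq_iff:
  assumes "A \<in> obj C" "B \<in> obj C" "\<beta> \<in> carrier (fibre P (A \<otimes> B))" "\<alpha> \<in> carrier (fibre P A)"
  shows "\<alpha> \<turnstile>\<^bsub>A\<^esub> allq C P (pr1 C A B) \<beta> \<longleftrightarrow> rx P (pr1 C A B) \<alpha> \<turnstile>\<^bsub>A \<otimes> B\<^esub> \<beta>"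
proof -
  interpret galois_connection "\<lparr>orderA = fibre P A, orderB = fibre P (A \<otimes> B),
      lower = rx P (pr1 C A B), upper = allq C P (pr1 C A B)\<rparr>"
    using allq_adjoint[of "pr1 C A B"] assms by (simp add: is_right_adjoint_def)
  show ?thesis
    using galois_property assms by simp
qed

lemma rx_allq:
  assumes "h \<in> arr C" "B \<in> obj C" "\<beta> \<in> carrier (fibre P (tgt C h \<otimes> B))"
  shows "rx P h (allq C P (pr1 C (tgt C h) B) \<beta>) = allq C P (pr1 C (src C h) B)
    (rx P \<langle>h \<cdot> pr1 C (src C h) B, pr2 C (src C h) B\<rangle> \<beta>)"
  using all_beck_chevalley[OF _ _ weakening_pullback] assms by (simp add: bc_all_def)

lemma entails_all_iff:
  assumes "\<delta> \<in> carrier (fibre P Z)" "\<beta> \<in> carrier (fibre P (A \<otimes> B))" "B \<in> obj C"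
    and "h \<in> arr C" "src C h = Z" "tgt C h = A"
  shows "\<delta> \<turnstile>\<^bsub>Z\<^esub> rx P h (allq C P (pr1 C A B) \<beta>) \<longleftrightarrow>
    rx P (pr1 C Z B) \<delta> \<turnstile>\<^bsub>Z \<otimes> B\<^esub> rx P \<langle>h \<cdot> pr1 C Z B, pr2 C Z B\<rangle> \<beta>"
  using assms rx_allq[of h B \<beta>] allq_iff[of Z B "rx P \<langle>h \<cdot> pr1 C Z B, pr2 C Z B\<rangle> \<beta>" \<delta>]
  by auto

text \<open>The decisive instance is the generic one, at stage \<open>Z \<otimes> B\<close> with
  \<open>k\<close> and \<open>g\<close> the two projections. By Beck-Chevalley and the adjunction it
  is equivalent to the quantified entailment.\<close>

lemma entails_allI:
  assumes "\<delta> \<in> carrier (fibre P Z)" "\<beta> \<in> carrier (fibre P (A \<otimes> B))" "B \<in> obj C"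
    and "h \<in> arr C" "src C h = Z" "tgt C h = A"
    and "\<And>W k g. k \<in> arr C \<Longrightarrow> src C k = W \<Longrightarrow> tgt C k = Z \<Longrightarrow> g \<in> arr C \<Longrightarrow> src C g = W \<Longrightarrow>
      tgt C g = B \<Longrightarrow> W \<in> obj C \<Longrightarrow> rx P k \<delta> \<turnstile>\<^bsub>W\<^esub> rx P \<langle>h \<cdot> k, g\<rangle> \<beta>"
  shows "\<delta> \<turnstile>\<^bsub>Z\<^esub> rx P h (allq C P (pr1 C A B) \<beta>)"
proof -
  have "Z \<in> obj C"
    using assms by auto
  then show ?thesis
    using assms(1-6) by (simp add: entails_all_iff assms(7))
qed

text \<open>Any instance arises from the generic one by reindexing along
  \<open>\<langle>k, g\<rangle>\<close>.\<close>

lemma entails_allD: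
  assumes "\<delta> \<turnstile>\<^bsub>Z\<^esub> rx P h (allq C P (pr1 C A B) \<beta>)"
    and "\<delta> \<in> carrier (fibre P Z)" "\<beta> \<in> carrier (fibre P (A \<otimes> B))" "B \<in> obj C"
    and "h \<in> arr C" "src C h = Z" "tgt C h = A"
    and "k \<in> arr C" "src C k = W" "tgt C k = Z" "g \<in> arr C" "src C g = W" "tgt C g = B"
  shows "rx P k \<delta> \<turnstile>\<^bsub>W\<^esub> rx P \<langle>h \<cdot> k, g\<rangle> \<beta>"
proof -
  have [simp]: "Z \<in> obj C"
    using assms by auto
  have "rx P (pr1 C Z B) \<delta> \<turnstile>\<^bsub>Z \<otimes> B\<^esub> rx P \<langle>h \<cdot> pr1 C Z B, pr2 C Z B\<rangle> \<beta>"
    using assms by (simp add: entails_all_iff)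
  then have "rx P \<langle>k, g\<rangle> (rx P (pr1 C Z B) \<delta>) \<turnstile>\<^bsub>W\<^esub>
      rx P \<langle>k, g\<rangle> (rx P \<langle>h \<cdot> pr1 C Z B, pr2 C Z B\<rangle> \<beta>)"
    by (rule rx_entails) (use assms in simp_all)
  then show ?thesis
    using assms by simp
qed

end

section \<open>Skolem and Goedel doctrines\<close>

lemma partial_order_carrier_subset:
  assumes "partial_order L" "S \<subseteq> carrier L"
  shows "partial_order (L\<lparr>carrier := S\<rparr>)"
proof -
  interpret partial_order L
    by fact
  show ?thesis
    by unfold_locales
      (use assms(2) in \<open>auto intro: le_antisym le_trans simp: eq_is_equal subset_iff\<close>)
qed

context skolem_doctrine
begin

lemma allq_ex_free [simp]:
  assumes "A \<in> obj C" "B \<in> obj C" "ex_free C P (A \<otimes> B) \<beta>"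
  shows "ex_free C P A (allq C P (pr1 C A B) \<beta>)"
  using all_ex_free[of "pr1 C A B" \<beta>] assms by simp

text \<open>In a Skolem doctrine the universal quantifier preserves existential-free predicates, so
  it restricts to a right adjoint in the subdoctrine. Both sides come from a choice of adjoint, and
  adjoints between posets are unique.\<close>

lemma allq_ex_free_subdoctrine:
  assumes A: "A \<in> obj C" and B: "B \<in> obj C" and \<beta>: "ex_free C P (A \<otimes> B) \<beta>"
  shows "allq C (ex_free_subdoctrine C P) (pr1 C A B) \<beta> = allq C P (pr1 C A B) \<beta>"
proof -
  let ?S = "ex_free_subdoctrine C P" and ?p = "pr1 C A B"
  note S = ex_free_subdoctrine_def
  have order: "partial_order (fibre ?S D)" if "D \<in> obj C" for D
    unfolding S using that by (auto intro!: partial_order_carrier_subset fibre_order)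
  have "is_right_adjoint C ?S ?p (allq C P ?p)"
    unfolding is_right_adjoint_def
    using A B order[of A] order[of "A \<otimes> B"]
    by (intro galois_connection.intro connection.intro galois_connection_axioms.intro)
      (auto simp: S allq_iff)
  then have "is_right_adjoint C ?S ?p (allq C ?S ?p)"
    unfolding allq_def[of C ?S]
    by (rule someI[where P = "is_right_adjoint C ?S ?p"])
  then interpret S: galois_connection "\<lparr>orderA = fibre ?S A, orderB = fibre ?S (A \<otimes> B),
      lower = rx ?S ?p, upper = allq C ?S ?p\<rparr>"
    using A B by (simp add: is_right_adjoint_def)
  have free: "ex_free C P A (allq C ?S ?p \<beta>)"
    using S.upper_closed[of \<beta>] \<beta> by (simp add: S)
  \<comment> \<open>Both values have the same existential-free lower bounds. Each is itself
    existential-free, so each lies below the other.\<close>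
  have iff: "\<alpha> \<turnstile>\<^bsub>A\<^esub> allq C ?S ?p \<beta> \<longleftrightarrow> \<alpha> \<turnstile>\<^bsub>A\<^esub> allq C P ?p \<beta>" if "ex_free C P A \<alpha>" for \<alpha>
    using S.galois_property[of \<alpha> \<beta>] allq_iff[of A B \<beta> \<alpha>] that A B \<beta> by (simp add: S)
  show ?thesis
    by (rule entails_antisym[where A = A]) (use iff[OF free] iff free A B \<beta> in auto)
qed

text \<open>The splitting property at the identity arrow, with the quantifier of the subdoctrine
  replaced by that of \<open>P\<close>. The body \<open>\<beta>\<close> must be existential-free to
  be admissible in the test.\<close>

lemma all_free_split:
  assumes "all_free C (ex_free_subdoctrine C P) D \<alpha>" "D \<in> obj C" "B \<in> obj C"
    and "ex_free C P (D \<otimes> B) \<beta>" "allq C P (pr1 C D B) \<beta> \<turnstile>\<^bsub>D\<^esub> \<alpha>"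
  obtains g where "g \<in> arr C" "src C g = D" "tgt C g = B" "rx P \<langle>ide C D, g\<rangle> \<beta> \<turnstile>\<^bsub>D\<^esub> \<alpha>"
proof -
  have "ex_free C P D \<alpha>"
    using assms(1) by (simp add: all_free_def ex_free_subdoctrine_def)
  then have "rx P (ide C D) \<alpha> = \<alpha>"
    using assms by simp
  then have "all_splitting C (ex_free_subdoctrine C P) D \<alpha>"
    using assms(1) ide_hom[OF assms(2)] unfolding all_free_def ex_free_subdoctrine_def by force
  then show ?thesis
    using assms that allq_ex_free_subdoctrine[of D B \<beta>]
    unfolding all_splitting_def by (force simp: ex_free_subdoctrine_def hom_iff)
qed

text \<open>Write \<open>\<alpha>\<close> as the existential quantification of an existential-free
  \<open>\<gamma>\<close> over \<open>A\<close>. At the stage given by the projection to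
  \<open>I\<close>, \<open>\<gamma>\<close> forces \<open>\<alpha>\<close>, hence
  \<open>\<beta>\<close>, and the adjunction turns this back into an entailment over
  \<open>I\<close>.\<close>

lemma entails_by_ex_free:
  assumes I: "I \<in> obj C" and \<alpha>: "\<alpha> \<in> carrier (fibre P I)" and \<beta>: "\<beta> \<in> carrier (fibre P I)"
    and forced: "\<And>Z h \<delta>. ex_free C P Z \<delta> \<Longrightarrow> h \<in> arr C \<Longrightarrow> src C h = Z \<Longrightarrow> tgt C h = I \<Longrightarrow>
      Z \<in> obj C \<Longrightarrow> \<delta> \<turnstile>\<^bsub>Z\<^esub> rx P h \<alpha> \<Longrightarrow> \<delta> \<turnstile>\<^bsub>Z\<^esub> rx P h \<beta>"
  shows "\<alpha> \<turnstile>\<^bsub>I\<^esub> \<beta>"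
proof -
  obtain A \<gamma> where A: "A \<in> obj C" and \<gamma>: "ex_free C P (I \<otimes> A) \<gamma>"
    and \<alpha>_eq: "\<alpha> = exq C P (pr1 C I A) \<gamma>"
    using enough_existential_free I \<alpha> unfolding enough_ex_free_def by blast
  have "\<gamma> \<turnstile>\<^bsub>I \<otimes> A\<^esub> rx P (pr1 C I A) \<alpha>"
    using exq_iff[of I A \<gamma> \<alpha>] I A \<alpha> \<gamma> by (simp add: \<alpha>_eq)
  then have "\<gamma> \<turnstile>\<^bsub>I \<otimes> A\<^esub> rx P (pr1 C I A) \<beta>"
    using \<gamma> I A by (auto intro: forced)
  then show ?thesis
    using I A \<beta> \<gamma> by (simp add: \<alpha>_eq exq_iff)
qed

end

text \<open>The supply of universal-free predicates is a property of the subdoctrine; since the two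
  universal quantifiers agree there, it yields a representation in \<open>P\<close> itself.\<close>

lemma (in goedel_doctrine) ex_free_eq_allq:
  assumes "I \<in> obj C" "ex_free C P I \<alpha>"
  obtains A \<beta> where "A \<in> obj C" "ex_free C P (I \<otimes> A) \<beta>" "\<alpha> = allq C P (pr1 C I A) \<beta>"
proof -
  have "\<alpha> \<in> carrier (fibre (ex_free_subdoctrine C P) I)"
    using assms by (simp add: ex_free_subdoctrine_def)
  then obtain A \<beta> where A: "A \<in> obj C"
    and free: "all_free C (ex_free_subdoctrine C P) (I \<otimes> A) \<beta>"
    and eq: "\<alpha> = allq C (ex_free_subdoctrine C P) (pr1 C I A) \<beta>"
    using enough_universal_free assms unfolding enough_all_free_def by blast
  have "ex_free C P (I \<otimes> A) \<beta>"
    using free by (simp add: all_free_def ex_free_subdoctrine_def)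
  with A eq assms show ?thesis
    using that allq_ex_free_subdoctrine by metis
qed

section \<open>Fibrewise Heyting structure\<close>

context heyting_algebra
begin

lemma himp_greatest:
  assumes "a \<in> carrier L" "b \<in> carrier L"
  shows "greatest L (himp L a b) {x \<in> carrier L. x \<sqinter> a \<sqsubseteq> b}"
  unfolding himp_def by (rule someI_ex[OF himp_exists[OF assms]])

lemma himp_closed:
  assumes "a \<in> carrier L" "b \<in> carrier L"
  shows "himp L a b \<in> carrier L"
  using himp_greatest[OF assms] unfolding greatest_def by blast

lemma meet_mono_left:
  assumes "a \<sqsubseteq> b" "a \<in> carrier L" "b \<in> carrier L" "c \<in> carrier L"
  shows "a \<sqinter> c \<sqsubseteq> b \<sqinter> c"
  using assms by (meson le_trans meet_closed meet_le meet_left meet_right)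

text \<open>Residuation follows from \<open>himp\<close> being greatest, because meeting with
  \<open>a\<close> is monotone.\<close>

lemma himp_iff:
  assumes "a \<in> carrier L" "b \<in> carrier L" "x \<in> carrier L"
  shows "x \<sqsubseteq> himp L a b \<longleftrightarrow> x \<sqinter> a \<sqsubseteq> b"
proof
  assume "x \<sqsubseteq> himp L a b"
  then have "x \<sqinter> a \<sqsubseteq> himp L a b \<sqinter> a"
    using assms by (intro meet_mono_left himp_closed)
  moreover have "himp L a b \<sqinter> a \<sqsubseteq> b"
    using himp_greatest[OF assms(1,2)] unfolding greatest_def by blast
  ultimately show "x \<sqinter> a \<sqsubseteq> b"
    using assms himp_closed le_trans meet_closed by meson
next
  assume "x \<sqinter> a \<sqsubseteq> b"
  then show "x \<sqsubseteq> himp L a b"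
    using himp_greatest[OF assms(1,2)] assms(3) unfolding greatest_def Upper_def by blast
qed

lemma le_meet_iff:
  assumes "a \<in> carrier L" "b \<in> carrier L" "x \<in> carrier L"
  shows "x \<sqsubseteq> a \<sqinter> b \<longleftrightarrow> x \<sqsubseteq> a \<and> x \<sqsubseteq> b"
  using assms by (meson le_trans meet_closed meet_le meet_left meet_right)

end

section \<open>Connectives in the fibres and their reindexing\<close>

context first_order_hyperdoctrine
begin

lemma meet_carrier [simp]:
  assumes "A \<in> obj C" "\<alpha> \<in> carrier (fibre P A)" "\<beta> \<in> carrier (fibre P A)"
  shows "\<alpha> \<sqinter>\<^bsub>fibre P A\<^esub> \<beta> \<in> carrier (fibre P A)"
proof -
  interpret heyting_algebra "fibre P A"
    by (rule fibre_heyting) fact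
  show ?thesis
    using assms by simp
qed

lemma himp_carrier [simp]:
  assumes "A \<in> obj C" "\<alpha> \<in> carrier (fibre P A)" "\<beta> \<in> carrier (fibre P A)"
  shows "himp (fibre P A) \<alpha> \<beta> \<in> carrier (fibre P A)"
  using assms heyting_algebra.himp_closed fibre_heyting by metis

lemma entails_himp_iff:
  assumes "A \<in> obj C"
    and "\<alpha> \<in> carrier (fibre P A)" "\<beta> \<in> carrier (fibre P A)" "\<delta> \<in> carrier (fibre P A)"
  shows "\<delta> \<turnstile>\<^bsub>A\<^esub> himp (fibre P A) \<alpha> \<beta> \<longleftrightarrow> \<delta> \<sqinter>\<^bsub>fibre P A\<^esub> \<alpha> \<turnstile>\<^bsub>A\<^esub> \<beta>"
  using assms heyting_algebra.himp_iff fibre_heyting by metis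

lemma entails_meet_iff:
  assumes "A \<in> obj C"
    and "\<alpha> \<in> carrier (fibre P A)" "\<beta> \<in> carrier (fibre P A)" "\<delta> \<in> carrier (fibre P A)"
  shows "\<delta> \<turnstile>\<^bsub>A\<^esub> \<alpha> \<sqinter>\<^bsub>fibre P A\<^esub> \<beta> \<longleftrightarrow> \<delta> \<turnstile>\<^bsub>A\<^esub> \<alpha> \<and> \<delta> \<turnstile>\<^bsub>A\<^esub> \<beta>"
  using assms heyting_algebra.le_meet_iff fibre_heyting by metis

lemma meet_entails:
  assumes "A \<in> obj C" "\<alpha> \<in> carrier (fibre P A)" "\<beta> \<in> carrier (fibre P A)"
  shows "\<alpha> \<sqinter>\<^bsub>fibre P A\<^esub> \<beta> \<turnstile>\<^bsub>A\<^esub> \<alpha>" "\<alpha> \<sqinter>\<^bsub>fibre P A\<^esub> \<beta> \<turnstile>\<^bsub>A\<^esub> \<beta>"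
  using entails_meet_iff[of A \<alpha> \<beta> "\<alpha> \<sqinter>\<^bsub>fibre P A\<^esub> \<beta>"] assms by simp_all

lemma himp_mp:
  assumes "\<delta> \<turnstile>\<^bsub>A\<^esub> himp (fibre P A) \<alpha> \<beta>" "\<delta> \<turnstile>\<^bsub>A\<^esub> \<alpha>" "A \<in> obj C"
    and "\<alpha> \<in> carrier (fibre P A)" "\<beta> \<in> carrier (fibre P A)" "\<delta> \<in> carrier (fibre P A)"
  shows "\<delta> \<turnstile>\<^bsub>A\<^esub> \<beta>"
proof -
  have "\<delta> \<turnstile>\<^bsub>A\<^esub> \<delta> \<sqinter>\<^bsub>fibre P A\<^esub> \<alpha>"
    using assms by (simp add: entails_meet_iff)
  then show ?thesis
    by (rule entails_trans) (use assms in \<open>simp_all add: entails_himp_iff\<close>)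
qed

lemma rx_meet [simp]:
  assumes "f \<in> arr C" "tgt C f = A" "src C f = Z"
    and "\<alpha> \<in> carrier (fibre P A)" "\<beta> \<in> carrier (fibre P A)"
  shows "rx P f (\<alpha> \<sqinter>\<^bsub>fibre P A\<^esub> \<beta>) = rx P f \<alpha> \<sqinter>\<^bsub>fibre P Z\<^esub> rx P f \<beta>"
  using rx_heyting[of f Z A] assms by (simp add: hom_iff heyting_hom_def meet_pres_def)

lemma rx_himp [simp]:
  assumes "f \<in> arr C" "tgt C f = A" "src C f = Z"
    and "\<alpha> \<in> carrier (fibre P A)" "\<beta> \<in> carrier (fibre P A)"
  shows "rx P f (himp (fibre P A) \<alpha> \<beta>) = himp (fibre P Z) (rx P f \<alpha>) (rx P f \<beta>)"
  using rx_heyting[of f Z A] assms by (simp add: hom_iff heyting_hom_def)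

end

text \<open>Falsehood entails that some \<open>b\<close> of type \<open>B\<close> satisfies truth.
  If falsehood splits existentials, the witness of this vacuous claim is an arrow from
  \<open>A\<close> to \<open>B\<close>.\<close>

lemma (in goedel_first_order_hyperdoctrine) inhabited_if_bot_ex_free:
  assumes "A \<in> obj C" "B \<in> obj C" "ex_free C P A \<bottom>\<^bsub>fibre P A\<^esub>"
  obtains g where "g \<in> arr C" "src C g = A" "tgt C g = B"
proof -
  interpret F: heyting_algebra "fibre P A"
    by (rule fibre_heyting) fact
  interpret G: heyting_algebra "fibre P (A \<otimes> B)"
    by (rule fibre_heyting) (use assms in simp)
  have "\<bottom>\<^bsub>fibre P A\<^esub> \<turnstile>\<^bsub>A\<^esub> rx P (ide C A) (exq C P (pr1 C A B) \<top>\<^bsub>fibre P (A \<otimes> B)\<^esub>)"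
    using assms by simp
  from entails_exE[OF assms(3) this] show ?thesis
    using that assms by auto
qed

section \<open>The dialectica interpretation of implication\<close>

locale dialectica_implication = goedel_first_order_hyperdoctrine C P
  for C :: "('o, 'a, 'm) cartesian_scheme" (structure)
    and P :: "('o, 'a, 'p) doctrine_data" +
  fixes I U X V Y E\<^sub>0 E\<^sub>1 :: 'o
    and ev\<^sub>0 ev\<^sub>1 :: 'a
    and \<psi> \<phi> :: 'p
  assumes ex_free_meet:
      "\<lbrakk>A \<in> obj C; ex_free C P A \<alpha>; ex_free C P A \<beta>\<rbrakk> \<Longrightarrow> ex_free C P A (\<alpha> \<sqinter>\<^bsub>fibre P A\<^esub> \<beta>)"
    and bot_ex_free: "A \<in> obj C \<Longrightarrow> ex_free C P A \<bottom>\<^bsub>fibre P A\<^esub>"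
    and objs [simp]: "I \<in> obj C" "U \<in> obj C" "X \<in> obj C" "V \<in> obj C" "Y \<in> obj C"
    and exp\<^sub>0: "is_exponential C (I \<otimes> U) V E\<^sub>0 ev\<^sub>0"
    and exp\<^sub>1: "is_exponential C ((I \<otimes> U) \<otimes> Y) X E\<^sub>1 ev\<^sub>1"
    and \<psi>_free: "ex_free C P ((I \<otimes> U) \<otimes> X) \<psi>"
    and \<phi>_free: "ex_free C P ((I \<otimes> V) \<otimes> Y) \<phi>"
    and \<phi>_all_free: "all_free C (ex_free_subdoctrine C P) ((I \<otimes> V) \<otimes> Y) \<phi>"
begin

lemma exponential_objs [simp]: "E\<^sub>0 \<in> obj C" "E\<^sub>1 \<in> obj C"
  using exp\<^sub>0 exp\<^sub>1 by (simp_all add: is_exponential_def)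

lemma ev_arr [simp]:
  "ev\<^sub>0 \<in> arr C" "src C ev\<^sub>0 = E\<^sub>0 \<otimes> (I \<otimes> U)" "tgt C ev\<^sub>0 = V"
  "ev\<^sub>1 \<in> arr C" "src C ev\<^sub>1 = E\<^sub>1 \<otimes> ((I \<otimes> U) \<otimes> Y)" "tgt C ev\<^sub>1 = X"
  using exp\<^sub>0 exp\<^sub>1 by (simp_all add: is_exponential_def hom_iff)

lemma \<psi>_carrier [simp]: "\<psi> \<in> carrier (fibre P ((I \<otimes> U) \<otimes> X))"
  using \<psi>_free by simp

lemma \<phi>_carrier [simp]: "\<phi> \<in> carrier (fibre P ((I \<otimes> V) \<otimes> Y))"
  using \<phi>_free by simp

abbreviation "all_\<psi> \<equiv> allq C P (pr1 C (I \<otimes> U) X) \<psi>"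
abbreviation "all_\<phi> \<equiv> allq C P (pr1 C (I \<otimes> V) Y) \<phi>"
abbreviation "premise \<equiv> exq C P (pr1 C I U) all_\<psi>"
abbreviation "conclusion \<equiv> exq C P (pr1 C I V) all_\<phi>"

text \<open>Contexts grow by one variable at a time, in the order \<open>i\<close>,
  \<open>f\<^sub>0\<close>, \<open>f\<^sub>1\<close>, \<open>u\<close>; adding \<open>y\<close>
  gives the context of the matrix.\<close>

abbreviation "F\<^sub>0 \<equiv> I \<otimes> E\<^sub>0"
abbreviation "F\<^sub>1 \<equiv> F\<^sub>0 \<otimes> E\<^sub>1"
abbreviation "G \<equiv> F\<^sub>1 \<otimes> U"

text \<open>The quantifier-free body at generalised elements of stage \<open>W\<close>. With the
  elements as parameters, the matrix and all of its substitution instances have the same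
  shape.\<close>

definition clause where
  "clause W h f\<^sub>0 f\<^sub>1 u y = himp (fibre P W)
     (rx P \<langle>\<langle>h, u\<rangle>, ev\<^sub>1 \<cdot> \<langle>f\<^sub>1, \<langle>\<langle>h, u\<rangle>, y\<rangle>\<rangle>\<rangle> \<psi>)
     (rx P \<langle>\<langle>h, ev\<^sub>0 \<cdot> \<langle>f\<^sub>0, \<langle>h, u\<rangle>\<rangle>\<rangle>, y\<rangle> \<phi>)"

text \<open>The five arguments are the projections, that is, the generic elements of the full
  context.\<close>

definition matrix where
  "matrix = clause (G \<otimes> Y)
     (pr1 C I E\<^sub>0 \<cdot> pr1 C F\<^sub>0 E\<^sub>1 \<cdot> pr1 C F\<^sub>1 U \<cdot> pr1 C G Y)
     (pr2 C I E\<^sub>0 \<cdot> pr1 C F\<^sub>0 E\<^sub>1 \<cdot> pr1 C F\<^sub>1 U \<cdot> pr1 C G Y)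
     (pr2 C F\<^sub>0 E\<^sub>1 \<cdot> pr1 C F\<^sub>1 U \<cdot> pr1 C G Y)
     (pr2 C F\<^sub>1 U \<cdot> pr1 C G Y)
     (pr2 C G Y)"

abbreviation "all_matrix \<equiv> allq C P (pr1 C F\<^sub>1 U) (allq C P (pr1 C G Y) matrix)"
abbreviation "prenex \<equiv> exq C P (pr1 C I E\<^sub>0) (exq C P (pr1 C F\<^sub>0 E\<^sub>1) all_matrix)"

lemma matrix_carrier [simp]: "matrix \<in> carrier (fibre P (G \<otimes> Y))"
  by (simp add: matrix_def clause_def)

lemma rx_matrix [simp]:
  assumes "h \<in> arr C" "f\<^sub>0 \<in> arr C" "f\<^sub>1 \<in> arr C" "u \<in> arr C" "y \<in> arr C"
    and "src C h = W" "src C f\<^sub>0 = W" "src C f\<^sub>1 = W" "src C u = W" "src C y = W"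
    and "tgt C h = I" "tgt C f\<^sub>0 = E\<^sub>0" "tgt C f\<^sub>1 = E\<^sub>1" "tgt C u = U" "tgt C y = Y"
  shows "rx P \<langle>\<langle>\<langle>\<langle>h, f\<^sub>0\<rangle>, f\<^sub>1\<rangle>, u\<rangle>, y\<rangle> matrix = clause W h f\<^sub>0 f\<^sub>1 u y"
  using assms by (simp add: matrix_def clause_def)

section \<open>From functions \<open>f\<^sub>0\<close>, \<open>f\<^sub>1\<close> to the
  implication\<close>

lemma prenex_entails_implication: "prenex \<turnstile>\<^bsub>I\<^esub> himp (fibre P I) premise conclusion"
proof (rule entails_by_ex_free)
  fix Z h \<delta>
  assume \<delta>: "ex_free C P Z \<delta>" and h: "h \<in> arr C" "src C h = Z" "tgt C h = I" and Z: "Z \<in> obj C"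
    and forced: "\<delta> \<turnstile>\<^bsub>Z\<^esub> rx P h prenex"
  obtain f\<^sub>0 where f\<^sub>0: "f\<^sub>0 \<in> arr C" "src C f\<^sub>0 = Z" "tgt C f\<^sub>0 = E\<^sub>0"
    and forced\<^sub>0: "\<delta> \<turnstile>\<^bsub>Z\<^esub> rx P \<langle>h, f\<^sub>0\<rangle> (exq C P (pr1 C F\<^sub>0 E\<^sub>1) all_matrix)"
    by (rule entails_exE[OF \<delta> forced]) (use h in simp_all)
  obtain f\<^sub>1 where f\<^sub>1: "f\<^sub>1 \<in> arr C" "src C f\<^sub>1 = Z" "tgt C f\<^sub>1 = E\<^sub>1"
    and all: "\<delta> \<turnstile>\<^bsub>Z\<^esub> rx P \<langle>\<langle>h, f\<^sub>0\<rangle>, f\<^sub>1\<rangle> all_matrix"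
    by (rule entails_exE[OF \<delta> forced\<^sub>0]) (use h f\<^sub>0 in simp_all)
  let ?s = "\<langle>\<langle>h, f\<^sub>0\<rangle>, f\<^sub>1\<rangle>"
  \<comment> \<open>The premise is an existential, so its meet with \<open>\<delta>\<close> is not
    known to be existential-free. A second test on an existential-free \<open>\<epsilon>\<close> at
    a later stage is what yields a witness \<open>u\<close>.\<close>
  have "rx P h premise \<sqinter>\<^bsub>fibre P Z\<^esub> \<delta> \<turnstile>\<^bsub>Z\<^esub> rx P h conclusion"
  proof (rule entails_by_ex_free)
    fix W k \<epsilon>
    assume \<epsilon>: "ex_free C P W \<epsilon>" and k: "k \<in> arr C" "src C k = W" "tgt C k = Z" and W: "W \<in> obj C"
      and "\<epsilon> \<turnstile>\<^bsub>W\<^esub> rx P k (rx P h premise \<sqinter>\<^bsub>fibre P Z\<^esub> \<delta>)"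
    then have \<epsilon>\<delta>: "\<epsilon> \<turnstile>\<^bsub>W\<^esub> rx P k \<delta>"
      and forced_premise: "\<epsilon> \<turnstile>\<^bsub>W\<^esub> rx P (h \<cdot> k) premise"
      using \<delta> h by (simp_all add: entails_meet_iff)
    obtain u where u: "u \<in> arr C" "src C u = W" "tgt C u = U"
      and \<epsilon>\<psi>: "\<epsilon> \<turnstile>\<^bsub>W\<^esub> rx P \<langle>h \<cdot> k, u\<rangle> all_\<psi>"
      by (rule entails_exE[OF \<epsilon> forced_premise]) (use h k in simp_all)
    \<comment> \<open>The witness for the conclusion is the value of \<open>f\<^sub>0\<close> at the
      witness \<open>u\<close> of the premise.\<close>
    let ?v = "ev\<^sub>0 \<cdot> \<langle>f\<^sub>0 \<cdot> k, \<langle>h \<cdot> k, u\<rangle>\<rangle>"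
    have "rx P k \<delta> \<turnstile>\<^bsub>W\<^esub> rx P \<langle>?s \<cdot> k, u\<rangle> (allq C P (pr1 C G Y) matrix)"
      by (rule entails_allD[OF all]) (use \<delta> h f\<^sub>0 f\<^sub>1 k u in simp_all)
    then have inner: "\<epsilon> \<turnstile>\<^bsub>W\<^esub> rx P \<langle>?s \<cdot> k, u\<rangle> (allq C P (pr1 C G Y) matrix)"
      by (rule entails_trans[OF \<epsilon>\<delta>]) (use \<delta> \<epsilon> h f\<^sub>0 f\<^sub>1 k u W in simp_all)
    have "\<epsilon> \<turnstile>\<^bsub>W\<^esub> rx P \<langle>h \<cdot> k, ?v\<rangle> all_\<phi>"
    proof (rule entails_allI)
      fix W' k' y
      assume k': "k' \<in> arr C" "src C k' = W'" "tgt C k' = W"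
        and y: "y \<in> arr C" "src C y = W'" "tgt C y = Y" and W': "W' \<in> obj C"
      \<comment> \<open>For a given \<open>y\<close>, the premise is instantiated at the point
        chosen by \<open>f\<^sub>1\<close>; modus ponens in the matrix then gives
        \<open>\<phi>\<close>.\<close>
      let ?x = "ev\<^sub>1 \<cdot> \<langle>f\<^sub>1 \<cdot> (k \<cdot> k'), \<langle>\<langle>h \<cdot> (k \<cdot> k'), u \<cdot> k'\<rangle>, y\<rangle>\<rangle>"
      have "rx P k' \<epsilon> \<turnstile>\<^bsub>W'\<^esub> rx P \<langle>\<langle>?s \<cdot> k, u\<rangle> \<cdot> k', y\<rangle> matrix"
        by (rule entails_allD[OF inner]) (use \<epsilon> h f\<^sub>0 f\<^sub>1 k u k' y in simp_all)
      then have "rx P k' \<epsilon> \<turnstile>\<^bsub>W'\<^esub> clause W' (h \<cdot> (k \<cdot> k')) (f\<^sub>0 \<cdot> (k \<cdot> k')) (f\<^sub>1 \<cdot> (k \<cdot> k')) (u \<cdot> k') y"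
        using h f\<^sub>0 f\<^sub>1 k u k' y by simp
      moreover have "rx P k' \<epsilon> \<turnstile>\<^bsub>W'\<^esub> rx P \<langle>\<langle>h \<cdot> k, u\<rangle> \<cdot> k', ?x\<rangle> \<psi>"
        by (rule entails_allD[OF \<epsilon>\<psi>]) (use \<epsilon> h f\<^sub>1 k u k' y in simp_all)
      ultimately show "rx P k' \<epsilon> \<turnstile>\<^bsub>W'\<^esub> rx P \<langle>\<langle>h \<cdot> k, ?v\<rangle> \<cdot> k', y\<rangle> \<phi>"
        using \<epsilon> h f\<^sub>0 f\<^sub>1 k u k' y W' by (simp add: clause_def) (erule himp_mp, simp_all)
    qed (use \<epsilon> h f\<^sub>0 k u in simp_all)
    then have "\<epsilon> \<turnstile>\<^bsub>W\<^esub> rx P (h \<cdot> k) conclusion"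
      by (rule entails_exI) (use \<epsilon> h f\<^sub>0 k u in simp_all)
    then show "\<epsilon> \<turnstile>\<^bsub>W\<^esub> rx P k (rx P h conclusion)"
      using h k by simp
  qed (use \<delta> h Z in simp_all)
  then show "\<delta> \<turnstile>\<^bsub>Z\<^esub> rx P h (himp (fibre P I) premise conclusion)"
    using \<delta> h Z by (simp add: entails_himp_iff meet_comm)
qed simp_all

section \<open>From the implication to functions \<open>f\<^sub>0\<close>,
  \<open>f\<^sub>1\<close>\<close>

lemma all_\<psi>_free [simp]: "ex_free C P (I \<otimes> U) all_\<psi>"
  using \<psi>_free by simp

lemma implication_entails_prenex: "himp (fibre P I) premise conclusion \<turnstile>\<^bsub>I\<^esub> prenex"
proof (rule entails_by_ex_free)
  fix Z h \<delta>
  assume \<delta>: "ex_free C P Z \<delta>" and h: "h \<in> arr C" "src C h = Z" "tgt C h = I" and Z: "Z \<in> obj C"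
    and forced: "\<delta> \<turnstile>\<^bsub>Z\<^esub> rx P h (himp (fibre P I) premise conclusion)"
  \<comment> \<open>The stage is enlarged by a generic \<open>u\<close> of type \<open>U\<close>;
    \<open>w\<close> is the weakening.\<close>
  define w where "w = pr1 C Z U"
  define u where "u = pr2 C Z U"
  have w: "w \<in> arr C" "src C w = Z \<otimes> U" "tgt C w = Z"
    and u: "u \<in> arr C" "src C u = Z \<otimes> U" "tgt C u = U"
    using Z by (simp_all add: w_def u_def)
  \<comment> \<open>This is \<open>\<delta>\<close> together with the premise instantiated at the
    generic \<open>u\<close>. Removing the existential from the premise keeps the hypothesis
    existential-free, so it can still provide witnesses.\<close>
  define \<delta>' where "\<delta>' = rx P w \<delta> \<sqinter>\<^bsub>fibre P (Z \<otimes> U)\<^esub> rx P \<langle>h \<cdot> w, u\<rangle> all_\<psi>"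
  have \<delta>': "ex_free C P (Z \<otimes> U) \<delta>'"
    unfolding \<delta>'_def by (rule ex_free_meet) (use \<delta> h Z w u in simp_all)
  have "\<delta>' \<turnstile>\<^bsub>Z \<otimes> U\<^esub> rx P (h \<cdot> w) conclusion"
  proof (rule himp_mp)
    have "rx P w \<delta> \<turnstile>\<^bsub>Z \<otimes> U\<^esub> rx P w (rx P h (himp (fibre P I) premise conclusion))"
      by (rule rx_entails[OF forced]) (use \<delta> h Z w in simp_all)
    then have "rx P w \<delta> \<turnstile>\<^bsub>Z \<otimes> U\<^esub>
        himp (fibre P (Z \<otimes> U)) (rx P (h \<cdot> w) premise) (rx P (h \<cdot> w) conclusion)"
      using h w by simp
    moreover have "\<delta>' \<turnstile>\<^bsub>Z \<otimes> U\<^esub> rx P w \<delta>"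
      unfolding \<delta>'_def by (rule meet_entails) (use \<delta> h Z w u in simp_all)
    ultimately show "\<delta>' \<turnstile>\<^bsub>Z \<otimes> U\<^esub>
        himp (fibre P (Z \<otimes> U)) (rx P (h \<cdot> w) premise) (rx P (h \<cdot> w) conclusion)"
      using \<delta> \<delta>' h Z w entails_trans by simp
    have "\<delta>' \<turnstile>\<^bsub>Z \<otimes> U\<^esub> rx P \<langle>h \<cdot> w, u\<rangle> all_\<psi>"
      unfolding \<delta>'_def by (rule meet_entails) (use \<delta> h Z w u in simp_all)
    then show "\<delta>' \<turnstile>\<^bsub>Z \<otimes> U\<^esub> rx P (h \<cdot> w) premise"
      by (rule entails_exI) (use \<delta>' h w u in simp_all)
  qed (use \<delta>' h Z w in simp_all)
  \<comment> \<open>Independence of premise: the witness \<open>v\<close> is a function of the stage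
    and of \<open>u\<close>.\<close>
  then obtain g\<^sub>0 where g\<^sub>0: "g\<^sub>0 \<in> arr C" "src C g\<^sub>0 = Z \<otimes> U" "tgt C g\<^sub>0 = V"
    and forced_\<phi>: "\<delta>' \<turnstile>\<^bsub>Z \<otimes> U\<^esub> rx P \<langle>h \<cdot> w, g\<^sub>0\<rangle> all_\<phi>"
    by (rule entails_exE[OF \<delta>']) (use h w in simp_all)

  define D where "D = (Z \<otimes> U) \<otimes> Y"
  define d where "d = pr1 C (Z \<otimes> U) Y"
  define y where "y = pr2 C (Z \<otimes> U) Y"
  have D: "D \<in> obj C"
    and d: "d \<in> arr C" "src C d = D" "tgt C d = Z \<otimes> U"
    and y: "y \<in> arr C" "src C y = D" "tgt C y = Y"
    using Z by (simp_all add: D_def d_def y_def)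
  let ?\<phi> = "rx P \<langle>\<langle>h \<cdot> (w \<cdot> d), g\<^sub>0 \<cdot> d\<rangle>, y\<rangle> \<phi>"
  have "rx P d \<delta>' \<turnstile>\<^bsub>D\<^esub> rx P \<langle>\<langle>h \<cdot> w, g\<^sub>0\<rangle> \<cdot> d, y\<rangle> \<phi>"
    by (rule entails_allD[OF forced_\<phi>]) (use \<delta>' h w g\<^sub>0 d y in simp_all)
  then have d_\<delta>': "rx P d \<delta>' \<turnstile>\<^bsub>D\<^esub> ?\<phi>"
    using h w g\<^sub>0 d y by simp
  have rx_\<delta>': "rx P d \<delta>' =
      rx P (w \<cdot> d) \<delta> \<sqinter>\<^bsub>fibre P D\<^esub> rx P \<langle>h \<cdot> (w \<cdot> d), u \<cdot> d\<rangle> all_\<psi>"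
    using \<delta> h w u d by (simp add: \<delta>'_def)

  \<comment> \<open>A universal-free predicate splits against a single universal quantifier.
    Exposing \<open>\<delta>\<close> as one allows it to be merged with the quantifier over
    \<open>x\<close>.\<close>
  obtain B \<gamma> where B: "B \<in> obj C" and \<gamma>: "ex_free C P (Z \<otimes> B) \<gamma>"
    and \<delta>_eq: "\<delta> = allq C P (pr1 C Z B) \<gamma>"
    using ex_free_eq_allq[OF Z \<delta>] .
  define n where "n = pr1 C D (B \<otimes> X)"
  define b where "b = pr1 C B X \<cdot> pr2 C D (B \<otimes> X)"
  define x where "x = pr2 C B X \<cdot> pr2 C D (B \<otimes> X)"
  have n: "n \<in> arr C" "src C n = D \<otimes> (B \<otimes> X)" "tgt C n = D"
    and b: "b \<in> arr C" "src C b = D \<otimes> (B \<otimes> X)" "tgt C b = B"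
    and x: "x \<in> arr C" "src C x = D \<otimes> (B \<otimes> X)" "tgt C x = X"
    using D B by (simp_all add: n_def b_def x_def)
  \<comment> \<open>The merged body over \<open>D\<close>, in one block of variables
    \<open>b\<close>, \<open>x\<close> of type \<open>B \<otimes> X\<close>. It is existential-free,
    as the splitting test requires.\<close>
  define \<beta> where "\<beta> = rx P \<langle>w \<cdot> (d \<cdot> n), b\<rangle> \<gamma> \<sqinter>\<^bsub>fibre P (D \<otimes> (B \<otimes> X))\<^esub>
    rx P \<langle>\<langle>h \<cdot> (w \<cdot> (d \<cdot> n)), u \<cdot> (d \<cdot> n)\<rangle>, x\<rangle> \<psi>"
  have \<beta>: "ex_free C P (D \<otimes> (B \<otimes> X)) \<beta>"
    unfolding \<beta>_def by (rule ex_free_meet) (use \<gamma> \<psi>_free D B h w u d n b x in simp_all)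
  have rx_\<beta>: "rx P \<langle>k, \<langle>b', x'\<rangle>\<rangle> \<beta> = rx P \<langle>w \<cdot> (d \<cdot> k), b'\<rangle> \<gamma> \<sqinter>\<^bsub>fibre P W\<^esub>
      rx P \<langle>\<langle>h \<cdot> (w \<cdot> (d \<cdot> k)), u \<cdot> (d \<cdot> k)\<rangle>, x'\<rangle> \<psi>"
    if k: "k \<in> arr C" "src C k = W" "tgt C k = D"
      and b': "b' \<in> arr C" "src C b' = W" "tgt C b' = B"
      and x': "x' \<in> arr C" "src C x' = W" "tgt C x' = X" for W k b' x'
  proof -
    have "n \<cdot> \<langle>k, \<langle>b', x'\<rangle>\<rangle> = k" "b \<cdot> \<langle>k, \<langle>b', x'\<rangle>\<rangle> = b'" "x \<cdot> \<langle>k, \<langle>b', x'\<rangle>\<rangle> = x'"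
      using D B k b' x' by (simp_all add: n_def b_def x_def)
    then show ?thesis
      using k b' x' B D \<gamma> h w u d n b x by (simp add: \<beta>_def)
  qed

  define \<omega> where "\<omega> = allq C P (pr1 C D (B \<otimes> X)) \<beta>"
  have \<omega>: "\<omega> \<in> carrier (fibre P D)"
    using \<beta> D B by (simp add: \<omega>_def)
  \<comment> \<open>Instantiating the block takes an element of \<open>B\<close> and one of
    \<open>X\<close> at once, even to extract a single conjunct.\<close>
  have \<omega>_at: "rx P k \<omega> \<turnstile>\<^bsub>W\<^esub> rx P \<langle>w \<cdot> (d \<cdot> k), b'\<rangle> \<gamma>"
      "rx P k \<omega> \<turnstile>\<^bsub>W\<^esub> rx P \<langle>\<langle>h \<cdot> (w \<cdot> (d \<cdot> k)), u \<cdot> (d \<cdot> k)\<rangle>, x'\<rangle> \<psi>"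
    if k: "k \<in> arr C" "src C k = W" "tgt C k = D"
      and b': "b' \<in> arr C" "src C b' = W" "tgt C b' = B"
      and x': "x' \<in> arr C" "src C x' = W" "tgt C x' = X" for W k b' x'
  proof -
    have W: "W \<in> obj C"
      using k by auto
    have "\<omega> \<turnstile>\<^bsub>D\<^esub> rx P (ide C D) (allq C P (pr1 C D (B \<otimes> X)) \<beta>)"
      using \<omega> D B \<beta> by (simp flip: \<omega>_def)
    then have "rx P k \<omega> \<turnstile>\<^bsub>W\<^esub> rx P \<langle>ide C D \<cdot> k, \<langle>b', x'\<rangle>\<rangle> \<beta>"
      by (rule entails_allD) (use \<omega> \<beta> D B k b' x' in simp_all)
    then have "rx P k \<omega> \<turnstile>\<^bsub>W\<^esub> rx P \<langle>w \<cdot> (d \<cdot> k), b'\<rangle> \<gamma> \<sqinter>\<^bsub>fibre P W\<^esub>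
        rx P \<langle>\<langle>h \<cdot> (w \<cdot> (d \<cdot> k)), u \<cdot> (d \<cdot> k)\<rangle>, x'\<rangle> \<psi>"
      using k by (simp add: rx_\<beta>[OF k b' x'])
    then show "rx P k \<omega> \<turnstile>\<^bsub>W\<^esub> rx P \<langle>w \<cdot> (d \<cdot> k), b'\<rangle> \<gamma>"
      "rx P k \<omega> \<turnstile>\<^bsub>W\<^esub> rx P \<langle>\<langle>h \<cdot> (w \<cdot> (d \<cdot> k)), u \<cdot> (d \<cdot> k)\<rangle>, x'\<rangle> \<psi>"
      using W \<omega> \<gamma> B h w u d k b' x' by (simp_all add: entails_meet_iff)
  qed
  have "\<omega> \<turnstile>\<^bsub>D\<^esub> rx P d \<delta>'"
  proof -
    have "\<omega> \<turnstile>\<^bsub>D\<^esub> rx P (w \<cdot> d) (allq C P (pr1 C Z B) \<gamma>)"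
    proof (rule entails_allI)
      fix W k b'
      assume k: "k \<in> arr C" "src C k = W" "tgt C k = D"
        and b': "b' \<in> arr C" "src C b' = W" "tgt C b' = B" and W: "W \<in> obj C"
      \<comment> \<open>Only \<open>b'\<close> is given, so an arbitrary element of \<open>X\<close>
        completes the instance of the block; it exists because falsehood is
        existential-free.\<close>
      obtain x' where "x' \<in> arr C" "src C x' = W" "tgt C x' = X"
        using inhabited_if_bot_ex_free[OF W _ bot_ex_free[OF W]] objs by metis
      from \<omega>_at(1)[OF k b' this] show "rx P k \<omega> \<turnstile>\<^bsub>W\<^esub> rx P \<langle>(w \<cdot> d) \<cdot> k, b'\<rangle> \<gamma>"
        using w d k by simp
    qed (use \<omega> \<gamma> B w d in simp_all)
    moreover have "\<omega> \<turnstile>\<^bsub>D\<^esub> rx P \<langle>h \<cdot> (w \<cdot> d), u \<cdot> d\<rangle> all_\<psi>"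
    proof (rule entails_allI)
      fix W k x'
      assume k: "k \<in> arr C" "src C k = W" "tgt C k = D"
        and x': "x' \<in> arr C" "src C x' = W" "tgt C x' = X" and W: "W \<in> obj C"
      \<comment> \<open>Symmetrically, an arbitrary element of \<open>B\<close> completes the given
        \<open>x'\<close>.\<close>
      obtain b' where "b' \<in> arr C" "src C b' = W" "tgt C b' = B"
        using inhabited_if_bot_ex_free[OF W _ bot_ex_free[OF W]] B by metis
      from \<omega>_at(2)[OF k this x']
      show "rx P k \<omega> \<turnstile>\<^bsub>W\<^esub> rx P \<langle>\<langle>h \<cdot> (w \<cdot> d), u \<cdot> d\<rangle> \<cdot> k, x'\<rangle> \<psi>"
        using h w u d k by simp
    qed (use \<omega> h w u d in simp_all)
    ultimately show ?thesis
      using \<omega> \<delta> D h w u d by (simp add: rx_\<delta>' entails_meet_iff flip: \<delta>_eq)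
  qed
  then have "\<omega> \<turnstile>\<^bsub>D\<^esub> ?\<phi>"
    by (rule entails_trans[OF _ d_\<delta>']) (use \<omega> \<delta>' D h w g\<^sub>0 d y in simp_all)
  moreover have "all_free C (ex_free_subdoctrine C P) D ?\<phi>"
    by (rule all_free_subdoctrine_rx) (use \<phi>_all_free h w g\<^sub>0 d y in simp_all)
  \<comment> \<open>A form of Markov's principle: universal-freeness of \<open>\<phi>\<close> turns
    the universal hypothesis \<open>\<omega>\<close> into one instance of its body, depending on the
    stage, \<open>u\<close> and \<open>y\<close>.\<close>
  ultimately obtain g where g: "g \<in> arr C" "src C g = D" "tgt C g = B \<otimes> X"
    and g_split: "rx P \<langle>ide C D, g\<rangle> \<beta> \<turnstile>\<^bsub>D\<^esub> ?\<phi>"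
    using all_free_split[of D ?\<phi> "B \<otimes> X" \<beta>] D B \<beta> unfolding \<omega>_def by auto
  define g\<^sub>b where "g\<^sub>b = pr1 C B X \<cdot> g"
  define g\<^sub>1 where "g\<^sub>1 = pr2 C B X \<cdot> g"
  have g\<^sub>b: "g\<^sub>b \<in> arr C" "src C g\<^sub>b = D" "tgt C g\<^sub>b = B"
    and g\<^sub>1: "g\<^sub>1 \<in> arr C" "src C g\<^sub>1 = D" "tgt C g\<^sub>1 = X"
    and g_eq: "g = \<langle>g\<^sub>b, g\<^sub>1\<rangle>"
    using g B by (simp_all add: g\<^sub>b_def g\<^sub>1_def pair_eta)
  let ?\<psi> = "rx P \<langle>\<langle>h \<cdot> (w \<cdot> d), u \<cdot> d\<rangle>, g\<^sub>1\<rangle> \<psi>"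
  \<comment> \<open>Evaluating \<open>\<beta>\<close> at the identity on \<open>D\<close> and at the
    components of \<open>g\<close>, then moving \<open>\<psi>\<close> to the right by
    residuation.\<close>
  have \<gamma>_imp: "rx P \<langle>w \<cdot> d, g\<^sub>b\<rangle> \<gamma> \<turnstile>\<^bsub>D\<^esub> himp (fibre P D) ?\<psi> ?\<phi>"
    using g_split rx_\<beta>[of "ide C D" D g\<^sub>b g\<^sub>1] D B \<gamma> h w u g\<^sub>0 d y g\<^sub>b g\<^sub>1
    by (simp add: g_eq entails_himp_iff)
  \<comment> \<open>The auxiliary witness \<open>g\<^sub>b\<close> disappears here:
    \<open>\<delta>\<close> entails every instance of \<open>\<gamma>\<close>, in particular this
    one.\<close>
  have "\<delta> \<turnstile>\<^bsub>Z\<^esub> rx P (ide C Z) (allq C P (pr1 C Z B) \<gamma>)"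
    using \<delta> Z by (simp flip: \<delta>_eq)
  then have "rx P (w \<cdot> d) \<delta> \<turnstile>\<^bsub>D\<^esub> rx P \<langle>ide C Z \<cdot> (w \<cdot> d), g\<^sub>b\<rangle> \<gamma>"
    by (rule entails_allD) (use \<delta> \<gamma> Z B w d g\<^sub>b in simp_all)
  then have "rx P (w \<cdot> d) \<delta> \<turnstile>\<^bsub>D\<^esub> rx P \<langle>w \<cdot> d, g\<^sub>b\<rangle> \<gamma>"
    using w d by simp
  then have \<delta>_imp: "rx P (w \<cdot> d) \<delta> \<turnstile>\<^bsub>D\<^esub> himp (fibre P D) ?\<psi> ?\<phi>"
    by (rule entails_trans[OF _ \<gamma>_imp]) (use \<delta> \<gamma> D B h w u g\<^sub>0 d y g\<^sub>b g\<^sub>1 in simp_all)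

  \<comment> \<open>The arrow \<open>g\<^sub>0\<close> depends on the stage and \<open>u\<close>,
    whereas the exponent is \<open>I \<otimes> U\<close>. The arrow to be curried discards the
    component in \<open>I\<close>, which the stage already determines through
    \<open>h\<close>.\<close>
  obtain f\<^sub>0 where f\<^sub>0: "f\<^sub>0 \<in> arr C" "src C f\<^sub>0 = Z" "tgt C f\<^sub>0 = E\<^sub>0"
    and ev\<^sub>0: "\<And>k a. k \<in> arr C \<Longrightarrow> a \<in> arr C \<Longrightarrow> tgt C k = Z \<Longrightarrow> tgt C a = I \<otimes> U \<Longrightarrow>
      src C k = src C a \<Longrightarrow> ev\<^sub>0 \<cdot> \<langle>f\<^sub>0 \<cdot> k, a\<rangle> =
      (g\<^sub>0 \<cdot> \<langle>pr1 C Z (I \<otimes> U), pr2 C I U \<cdot> pr2 C Z (I \<otimes> U)\<rangle>) \<cdot> \<langle>k, a\<rangle>"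
    by (rule curry_ex[OF exp\<^sub>0 Z,
        where f = "g\<^sub>0 \<cdot> \<langle>pr1 C Z (I \<otimes> U), pr2 C I U \<cdot> pr2 C Z (I \<otimes> U)\<rangle>"])
      (use g\<^sub>0 Z in simp_all)
  let ?J = "(I \<otimes> U) \<otimes> Y"
  \<comment> \<open>Likewise, \<open>g\<^sub>1\<close> is curried after discarding the component in
    \<open>I\<close> of the argument \<open>(i, u, y)\<close>.\<close>
  let ?g\<^sub>1 = "g\<^sub>1 \<cdot> \<langle>\<langle>pr1 C Z ?J, pr2 C I U \<cdot> (pr1 C (I \<otimes> U) Y \<cdot> pr2 C Z ?J)\<rangle>,
    pr2 C (I \<otimes> U) Y \<cdot> pr2 C Z ?J\<rangle>"
  obtain f\<^sub>1 where f\<^sub>1: "f\<^sub>1 \<in> arr C" "src C f\<^sub>1 = Z" "tgt C f\<^sub>1 = E\<^sub>1"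
    and ev\<^sub>1: "\<And>k a. k \<in> arr C \<Longrightarrow> a \<in> arr C \<Longrightarrow> tgt C k = Z \<Longrightarrow> tgt C a = ?J \<Longrightarrow>
      src C k = src C a \<Longrightarrow> ev\<^sub>1 \<cdot> \<langle>f\<^sub>1 \<cdot> k, a\<rangle> = ?g\<^sub>1 \<cdot> \<langle>k, a\<rangle>"
    by (rule curry_ex[OF exp\<^sub>1 Z, where f = ?g\<^sub>1]) (use g\<^sub>1 Z D_def in simp_all)
  let ?s = "\<langle>\<langle>h, f\<^sub>0\<rangle>, f\<^sub>1\<rangle>"
  have "\<delta> \<turnstile>\<^bsub>Z\<^esub> rx P ?s all_matrix"
  proof (rule entails_allI)
    fix W k u'
    assume k: "k \<in> arr C" "src C k = W" "tgt C k = Z"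
      and u': "u' \<in> arr C" "src C u' = W" "tgt C u' = U" and W: "W \<in> obj C"
    show "rx P k \<delta> \<turnstile>\<^bsub>W\<^esub> rx P \<langle>?s \<cdot> k, u'\<rangle> (allq C P (pr1 C G Y) matrix)"
    proof (rule entails_allI)
      fix W' k' y'
      assume k': "k' \<in> arr C" "src C k' = W'" "tgt C k' = W"
        and y': "y' \<in> arr C" "src C y' = W'" "tgt C y' = Y" and W': "W' \<in> obj C"
      \<comment> \<open>The point of \<open>D\<close> given by the stage together with the current
        values of \<open>u\<close> and \<open>y\<close>; reindexing \<open>\<delta>_imp\<close>
        along it produces the required clause.\<close>
      let ?t = "\<langle>\<langle>k \<cdot> k', u' \<cdot> k'\<rangle>, y'\<rangle>"
      have t: "?t \<in> arr C" "src C ?t = W'" "tgt C ?t = D"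
        and dt: "d \<cdot> ?t = \<langle>k \<cdot> k', u' \<cdot> k'\<rangle>" "w \<cdot> \<langle>k \<cdot> k', u' \<cdot> k'\<rangle> = k \<cdot> k'"
          "u \<cdot> \<langle>k \<cdot> k', u' \<cdot> k'\<rangle> = u' \<cdot> k'" "y \<cdot> ?t = y'"
        using Z k u' k' y' by (simp_all add: D_def d_def w_def u_def y_def)
      have ev: "ev\<^sub>0 \<cdot> \<langle>f\<^sub>0 \<cdot> (k \<cdot> k'), \<langle>h \<cdot> (k \<cdot> k'), u' \<cdot> k'\<rangle>\<rangle> = g\<^sub>0 \<cdot> \<langle>k \<cdot> k', u' \<cdot> k'\<rangle>"
        "ev\<^sub>1 \<cdot> \<langle>f\<^sub>1 \<cdot> (k \<cdot> k'), \<langle>\<langle>h \<cdot> (k \<cdot> k'), u' \<cdot> k'\<rangle>, y'\<rangle>\<rangle> = g\<^sub>1 \<cdot> ?t"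
        using Z h g\<^sub>0 g\<^sub>1 k u' k' y' by (simp_all add: ev\<^sub>0 ev\<^sub>1 D_def)
      have "rx P ?t (rx P (w \<cdot> d) \<delta>) \<turnstile>\<^bsub>W'\<^esub> rx P ?t (himp (fibre P D) ?\<psi> ?\<phi>)"
        by (rule rx_entails[OF \<delta>_imp]) (use t D \<delta> h w u g\<^sub>0 d y g\<^sub>1 in simp_all)
      then have "rx P (k \<cdot> k') \<delta> \<turnstile>\<^bsub>W'\<^esub>
          clause W' (h \<cdot> (k \<cdot> k')) (f\<^sub>0 \<cdot> (k \<cdot> k')) (f\<^sub>1 \<cdot> (k \<cdot> k')) (u' \<cdot> k') y'"
        using \<delta> Z h w u g\<^sub>0 d y g\<^sub>1 k u' k' y' W' by (simp add: clause_def ev dt D_def)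
      then show "rx P k' (rx P k \<delta>) \<turnstile>\<^bsub>W'\<^esub> rx P \<langle>\<langle>?s \<cdot> k, u'\<rangle> \<cdot> k', y'\<rangle> matrix"
        using \<delta> h f\<^sub>0 f\<^sub>1 k u' k' y' by simp
    qed (use \<delta> h f\<^sub>0 f\<^sub>1 k u' in simp_all)
  qed (use \<delta> h f\<^sub>0 f\<^sub>1 in simp_all)
  then have "\<delta> \<turnstile>\<^bsub>Z\<^esub> rx P \<langle>h, f\<^sub>0\<rangle> (exq C P (pr1 C F\<^sub>0 E\<^sub>1) all_matrix)"
    by (rule entails_exI) (use \<delta> h f\<^sub>0 f\<^sub>1 in simp_all)
  then show "\<delta> \<turnstile>\<^bsub>Z\<^esub> rx P h prenex"
    by (rule entails_exI) (use \<delta> h f\<^sub>0 in simp_all)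
qed simp_all

end

theorem theorem5p11:
  fixes C :: "('o, 'a) cartesian" (structure)
    and P :: "('o, 'a, 'p) doctrine_data"
    and I U X V Y E\<^sub>0 E\<^sub>1 :: 'o
    and ev\<^sub>0 ev\<^sub>1 :: 'a
    and \<psi> \<phi> :: 'p
  assumes "goedel_first_order_hyperdoctrine C P"
    and "\<And>A \<alpha> \<beta>. \<lbrakk>A \<in> obj C; ex_free C P A \<alpha>; ex_free C P A \<beta>\<rbrakk>
            \<Longrightarrow> ex_free C P A (himp (fibre P A) \<alpha> \<beta>)"
    and "\<And>A \<alpha> \<beta>. \<lbrakk>A \<in> obj C; ex_free C P A \<alpha>; ex_free C P A \<beta>\<rbrakk>
            \<Longrightarrow> ex_free C P A (\<alpha> \<sqinter>\<^bsub>fibre P A\<^esub> \<beta>)"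
    and "\<And>A. A \<in> obj C \<Longrightarrow> ex_free C P A \<top>\<^bsub>fibre P A\<^esub>"
    and "\<And>A. A \<in> obj C \<Longrightarrow> quantifier_free C P A \<bottom>\<^bsub>fibre P A\<^esub>"
    and "I \<in> obj C" "U \<in> obj C" "X \<in> obj C" "V \<in> obj C" "Y \<in> obj C"
    and "is_exponential C (I \<otimes> U) V E\<^sub>0 ev\<^sub>0"
    and "is_exponential C ((I \<otimes> U) \<otimes> Y) X E\<^sub>1 ev\<^sub>1"
    and "quantifier_free C P ((I \<otimes> U) \<otimes> X) \<psi>"
    and "quantifier_free C P ((I \<otimes> V) \<otimes> Y) \<phi>"
  shows
    "let lhs = himp (fibre P I)
                 (exq C P (pr1 C I U) (allq C P (pr1 C (I \<otimes> U) X) \<psi>))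
                 (exq C P (pr1 C I V) (allq C P (pr1 C (I \<otimes> V) Y) \<phi>));
         F\<^sub>0 = I \<otimes> E\<^sub>0; F\<^sub>1 = F\<^sub>0 \<otimes> E\<^sub>1; G = F\<^sub>1 \<otimes> U; H = G \<otimes> Y;
         y = pr2 C G Y;
         u = pr2 C F\<^sub>1 U \<cdot> pr1 C G Y;
         f\<^sub>1 = pr2 C F\<^sub>0 E\<^sub>1 \<cdot> pr1 C F\<^sub>1 U \<cdot> pr1 C G Y;
         f\<^sub>0 = pr2 C I E\<^sub>0 \<cdot> pr1 C F\<^sub>0 E\<^sub>1 \<cdot> pr1 C F\<^sub>1 U \<cdot> pr1 C G Y;
         i = pr1 C I E\<^sub>0 \<cdot> pr1 C F\<^sub>0 E\<^sub>1 \<cdot> pr1 C F\<^sub>1 U \<cdot> pr1 C G Y;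
         matrix = himp (fibre P H)
                    (rx P \<langle>\<langle>i, u\<rangle>, ev\<^sub>1 \<cdot> \<langle>f\<^sub>1, \<langle>\<langle>i, u\<rangle>, y\<rangle>\<rangle>\<rangle> \<psi>)
                    (rx P \<langle>\<langle>i, ev\<^sub>0 \<cdot> \<langle>f\<^sub>0, \<langle>i, u\<rangle>\<rangle>\<rangle>, y\<rangle> \<phi>);
         rhs = exq C P (pr1 C I E\<^sub>0) (exq C P (pr1 C F\<^sub>0 E\<^sub>1)
                 (allq C P (pr1 C F\<^sub>1 U) (allq C P (pr1 C G Y) matrix)))
     in lhs \<sqsubseteq>\<^bsub>fibre P I\<^esub> rhs \<and> rhs \<sqsubseteq>\<^bsub>fibre P I\<^esub> lhs"
proof -
  interpret goedel_first_order_hyperdoctrine C P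
    by (fact assms(1))
  interpret dialectica_implication C P I U X V Y E\<^sub>0 E\<^sub>1 ev\<^sub>0 ev\<^sub>1 \<psi> \<phi>
    using assms(3,5-) by unfold_locales (simp_all add: quantifier_free_def)
  show ?thesis
    using implication_entails_prenex prenex_entails_implication
    unfolding Let_def matrix_def clause_def by blast
qed

end
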